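(* Let $I_T\subset K[x_1,\dots,x_s]$ be a simple toric ideal, let $\omega\subseteq\{1,\dots,s\}$, and let $I_A$ be a $T_\omega$-robust toric ideal. The toric ideal $I_A$ is strongly robust if and only if $\omega$ is a face of the strongly robustness complex $\Delta_T$.
   Context: $K$ is a field. For an integer matrix $M$ with $n$ columns, $\operatorname{Ker}_{\mathbb Z}(M)=\{\mathbf u\in\mathbb Z^n: M\mathbf u=0\}$, and the toric ideal $I_M\subset K[x_1,\dots,x_n]$ is generated by the binomials $x^{\mathbf u^+}-x^{\mathbf u^-}$, $\mathbf u\in\operatorname{Ker}_{\mathbb Z}(M)$, where $\mathbf u=\mathbf u^+-\mathbf u^-$ with $\mathbf u^\pm\in\mathbb N^n$ of disjoint supports. Standing assumption: all toric ideals considered (here $I_A$ and $I_T$) come from matrices $M$ with $\operatorname{Ker}_{\mathbb Z}(M)\cap\mathbb N^n=\{\mathbf 0\}$ (positively graded). Bouquets. Let $A=[\mathbf a_1,\dots,\mathbf a_n]\in\mathbb Z^{m\times n}$ have rank $r$. Its Gale transform is an $n\times(n-r)$ integer matrix whose columns form a basis of the lattice $\operatorname{Ker}_{\mathbb Z}(A)$; its rows are $\mathbf b_1,\dots,\mathbf b_n$. The vector $\mathbf a_i$ is free if $\mathbf b_i=\mathbf 0$. The bouquet graph has vertices $\mathbf a_1,\dots,\mathbf a_n$ and edges $\{\mathbf a_i,\mathbf a_j\}$ whenever $\mathbf b_i$ is a rational multiple of $\mathbf b_j$ and vice versa; its connected components are the bouquets. The free vectors, if any, form one bouquet, the free bouquet.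 A non-free bouquet is mixed if it contains an edge $\{\mathbf a_i,\mathbf a_j\}$ with $\mathbf b_i=\lambda\mathbf b_j$ for some $\lambda<0$; otherwise (isolated vertex, or $\lambda>0$ for all its edges) it is non-mixed. List the bouquets as $B_1,\dots,B_s$ and reorder the columns as $\mathbf a_{11},\dots,\mathbf a_{1k_1},\dots,\mathbf a_{s1},\dots,\mathbf a_{sk_s}$, with $\mathbf a_{i1},\dots,\mathbf a_{ik_i}$ the elements of $B_i$. Define $\mathbf c_{B_i}\in\mathbb Z^n$, supported on the positions $i1,\dots,ik_i$ with coordinates $c_{i1},\dots,c_{ik_i}$ there: if $B_i$ is free, $\mathbf c_{B_i}$ is any vector with support exactly $\{i1,\dots,ik_i\}$ and $c_{i1}>0$; if $B_i$ is non-free, choose an index $l$ with $(\mathbf b_{ij})_l\neq0$ for all $j$, put $g_l=\gcd((\mathbf b_{i1})_l,\dots,(\mathbf b_{ik_i})_l)$ and $c_{ij}=\varepsilon_{i1}(\mathbf b_{ij})_l/g_l$, where $\varepsilon_{i1}$ is the sign of $(\mathbf b_{i1})_l$. Let $\mathbf a_{B_i}=\sum_j c_{ij}\mathbf a_{ij}$ and $A_B=[\mathbf a_{B_1},\dots,\mathbf a_{B_s}]$; the bouquet ideal of $I_A$ is $I_{A_B}\subset K[x_1,\dots,x_s]$. The map $D(\mathbf u)=\sum_{i=1}^s u_i\mathbf c_{B_i}$ is an isomorphism $\operatorname{Ker}_{\mathbb Z}(A_B)\to\operatorname{Ker}_{\mathbb Z}(A)$ (known fact). A toric ideal is simple if every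 bouquet is a singleton. Given a simple toric ideal $I_T\subset K[x_1,\dots,x_s]$ and $\omega\subseteq[s]=\{1,\dots,s\}$, a toric ideal $I_A$ is $T_\omega$-robust if its bouquet ideal is $I_T$ (so $\operatorname{Ker}_{\mathbb Z}(A_B)=\operatorname{Ker}_{\mathbb Z}(T)$, the bouquet $B_i$ corresponding to $x_i$) and $\omega=\{i: B_i\text{ is non-mixed}\}$. A binomial $x^{\mathbf u^+}-x^{\mathbf u^-}\in I_M$ is primitive if there is no other binomial $x^{\mathbf v^+}-x^{\mathbf v^-}\in I_M$ with $x^{\mathbf v^+}\mid x^{\mathbf u^+}$ and $x^{\mathbf v^-}\mid x^{\mathbf u^-}$ (here $\mathbf u,\mathbf v\neq\mathbf 0$). The Graver basis $\operatorname{Gr}(I_M)$ is the set of primitive binomials, and $\operatorname{Gr}(M)$ is the set of corresponding vectors $\mathbf u$. The set $S(M)$ of indispensable elements is the set of $\mathbf u\in\operatorname{Ker}_{\mathbb Z}(M)$ such that $x^{\mathbf u^+}-x^{\mathbf u^-}$ belongs, up to sign, to every minimal system of binomial generators of $I_M$. Opposite vectors (binomials) are identified in these sets. $I_M$ is strongly robust if its Graver basis is a minimal system of generators of $I_M$. For $\omega\subseteq[s]$, $S_\omega(T)=\{\mathbf u\in\operatorname{Gr}(T): D(\mathbf u)\in S(A)\}$, where $I_A$ is any $T_\omega$-robust toric ideal (this is independent of the choice of $I_A$). The strongly robustness complex of $T$ is $\Delta_T=\{\omega\subseteq[s]: S_\omega(T)=\operatorname{Gr}(T)\}$. *)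

theory Defs
  imports
    "HOL-Library.Poly_Mapping"
    "HOL-Algebra.Ideal"
    "HOL-Algebra.Divisibility"
    "Jordan_Normal_Form.Matrix_Kernel"
begin

text \<open>
  Columns, variables and bouquets are numbered from 0: the index set written
  \<open>[n] = {1, ..., n}\<close> on paper is \<open>{..<n}\<close> here. Integer matrices and vectors are those
  of Jordan_Normal_Form, and \<open>Ker\<^sub>\<int>(M)\<close> is \<open>mat_kernel M\<close> for \<open>M :: int mat\<close>.
\<close>

section \<open>Toric ideals\<close>

text \<open>Polynomials in variables \<open>x\<^sub>0, x\<^sub>1, ...\<close>; \<open>poly_ring n\<close> is \<open>K[x\<^sub>0, ..., x\<^bsub>n-1\<^esub>]\<close>.\<close>

type_synonym 'k mpoly = "(nat \<Rightarrow>\<^sub>0 nat) \<Rightarrow>\<^sub>0 'k"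

definition poly_ring :: "nat \<Rightarrow> 'k::field mpoly ring" where
  "poly_ring n =
     \<lparr> carrier = {p. \<forall>e \<in> Poly_Mapping.keys p. Poly_Mapping.keys e \<subseteq> {..<n}},
       monoid.mult = (*), one = 1, zero = 0, add = (+) \<rparr>"

definition monomial :: "(nat \<Rightarrow>\<^sub>0 nat) \<Rightarrow> 'k::field mpoly" where
  "monomial e = Poly_Mapping.single e 1"

text \<open>The exponent of \<open>x\<^bsup>u\<^sup>+\<^esup>\<close>; since \<open>nat\<close> truncates, \<open>u\<^sup>-\<close> is the positive part of \<open>-u\<close>.\<close>

definition pos_exp :: "int vec \<Rightarrow> (nat \<Rightarrow>\<^sub>0 nat)" where
  "pos_exp u = (\<Sum>i<dim_vec u. Poly_Mapping.single i (nat (u $ i)))"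

definition neg_exp :: "int vec \<Rightarrow> (nat \<Rightarrow>\<^sub>0 nat)" where
  "neg_exp u = pos_exp (- u)"

definition binom :: "int vec \<Rightarrow> 'k::field mpoly" where
  "binom u = monomial (pos_exp u) - monomial (neg_exp u)"

definition toric_ideal :: "int mat \<Rightarrow> 'k::field mpoly set" where
  "toric_ideal M = Idl\<^bsub>poly_ring (dim_col M)\<^esub> (binom ` mat_kernel M)"

definition positively_graded :: "int mat \<Rightarrow> bool" where
  "positively_graded M \<longleftrightarrow>
     {u \<in> mat_kernel M. \<forall>i<dim_col M. 0 \<le> u $ i} = {0\<^sub>v (dim_col M)}"

section \<open>Graver basis, indispensable elements, strong robustness\<close>

definition minimal_generators :: "nat \<Rightarrow> 'k::field mpoly set \<Rightarrow> 'k mpoly set \<Rightarrow> bool" where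
  "minimal_generators n I X \<longleftrightarrow>
     X \<subseteq> carrier (poly_ring n) \<and> Idl\<^bsub>poly_ring n\<^esub> X = I \<and>
     (\<forall>Y. Y \<subset> X \<longrightarrow> Idl\<^bsub>poly_ring n\<^esub> Y \<noteq> I)"

text \<open>
  A system of binomial generators consists of differences of two arbitrary monomials.
\<close>

definition is_binomial :: "'k::field mpoly \<Rightarrow> bool" where
  "is_binomial f \<longleftrightarrow> (\<exists>a b. a \<noteq> b \<and> f = monomial a - monomial b)"

definition primitive_vec :: "nat \<Rightarrow> 'k::field mpoly set \<Rightarrow> int vec \<Rightarrow> bool" where
  "primitive_vec n I u \<longleftrightarrow>
     u \<in> carrier_vec n \<and> u \<noteq> 0\<^sub>v n \<and> binom u \<in> I \<and>
     \<not> (\<exists>v \<in> carrier_vec n. v \<noteq> 0\<^sub>v n \<and> v \<noteq> u \<and> binom v \<in> I \<and>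
          (monomial (pos_exp v) :: 'k mpoly) divides\<^bsub>poly_ring n\<^esub> monomial (pos_exp u) \<and>
          (monomial (neg_exp v) :: 'k mpoly) divides\<^bsub>poly_ring n\<^esub> monomial (neg_exp u))"

text \<open>
  Opposite vectors (and binomials) are to be identified. The sets of vectors
  \<open>graver\<close> and \<open>indispensable\<close> and the set \<open>graver_basis\<close> of binomials are the full
  preimages under this identification, that is, they are closed under negation; where
  the identification matters (minimality of the Graver basis as a system of generators),
  one representative is taken from each pair of opposite elements. The field enters
  the sets of vectors through a type argument.
\<close>

definition graver_basis :: "nat \<Rightarrow> 'k::field mpoly set \<Rightarrow> 'k mpoly set" where
  "graver_basis n I = binom ` {u. primitive_vec n I u}"

definition graver :: "'k::field itself \<Rightarrow> int mat \<Rightarrow> int vec set" where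
  "graver _ M = {u. primitive_vec (dim_col M) (toric_ideal M :: 'k mpoly set) u}"

definition indispensable :: "'k::field itself \<Rightarrow> int mat \<Rightarrow> int vec set" where
  "indispensable _ M =
     {u \<in> mat_kernel M.
        \<forall>X :: 'k mpoly set.
          (\<forall>f \<in> X. is_binomial f) \<and> minimal_generators (dim_col M) (toric_ideal M) X
          \<longrightarrow> binom u \<in> X \<or> - binom u \<in> X}"

definition sign_representatives :: "'a::uminus set \<Rightarrow> 'a set \<Rightarrow> bool" where
  "sign_representatives X R \<longleftrightarrow>
     R \<subseteq> X \<and> (\<forall>f \<in> X. \<exists>!g. g \<in> R \<and> (g = f \<or> g = - f))"

definition strongly_robust :: "'k::field itself \<Rightarrow> int mat \<Rightarrow> bool" where
  "strongly_robust _ M \<longleftrightarrow>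
     (\<exists>R :: 'k mpoly set.
        sign_representatives (graver_basis (dim_col M) (toric_ideal M)) R \<and>
        minimal_generators (dim_col M) (toric_ideal M) R)"

section \<open>Bouquets\<close>

text \<open>
  A Gale transform has as columns a lattice basis of the integer kernel: each kernel
  vector is a unique integer combination of the columns. This forces the number of
  columns to be \<open>n - rank A\<close>. The notions below are stated for a given Gale transform
  \<open>G\<close>; they do not depend on which one is chosen.
\<close>

definition gale_transform :: "int mat \<Rightarrow> int mat \<Rightarrow> bool" where
  "gale_transform A G \<longleftrightarrow>
     dim_row G = dim_col A \<and>
     bij_betw (\<lambda>w. G *\<^sub>v w) (carrier_vec (dim_col G)) (mat_kernel A)"

definition rat_row :: "int mat \<Rightarrow> nat \<Rightarrow> rat vec" where
  "rat_row G i = map_vec rat_of_int (row G i)"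

definition bouquet_edges :: "int mat \<Rightarrow> (nat \<times> nat) set" where
  "bouquet_edges G =
     {(i, j). i < dim_row G \<and> j < dim_row G \<and> i \<noteq> j \<and>
        (\<exists>q. rat_row G i = q \<cdot>\<^sub>v rat_row G j) \<and>
        (\<exists>q. rat_row G j = q \<cdot>\<^sub>v rat_row G i)}"

definition bouquets :: "int mat \<Rightarrow> nat set set" where
  "bouquets G = {..<dim_row G} // (bouquet_edges G)\<^sup>*"

definition free_bouquet :: "int mat \<Rightarrow> nat set \<Rightarrow> bool" where
  "free_bouquet G B \<longleftrightarrow> (\<forall>i \<in> B. row G i = 0\<^sub>v (dim_col G))"

definition mixed_bouquet :: "int mat \<Rightarrow> nat set \<Rightarrow> bool" where
  "mixed_bouquet G B \<longleftrightarrow>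
     \<not> free_bouquet G B \<and>
     (\<exists>i \<in> B. \<exists>j \<in> B. (i, j) \<in> bouquet_edges G \<and>
        (\<exists>q<0. rat_row G i = q \<cdot>\<^sub>v rat_row G j))"

text \<open>A free bouquet is neither mixed nor non-mixed.\<close>

definition non_mixed_bouquet :: "int mat \<Rightarrow> nat set \<Rightarrow> bool" where
  "non_mixed_bouquet G B \<longleftrightarrow> \<not> free_bouquet G B \<and> \<not> mixed_bouquet G B"

text \<open>
  A bouquet with its elements listed in some order is a list \<open>B\<close> of column indices; its
  head is the element that determines the sign of the vector \<open>c\<close>.
\<close>

definition bouquet_vector :: "int mat \<Rightarrow> nat list \<Rightarrow> int vec \<Rightarrow> bool" where
  "bouquet_vector G B c \<longleftrightarrow>
     c \<in> carrier_vec (dim_row G) \<and>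
     (if free_bouquet G (set B)
      then {i. i < dim_row G \<and> c $ i \<noteq> 0} = set B \<and> c $ hd B > 0
      else \<exists>l<dim_col G. (\<forall>j \<in> set B. G $$ (j, l) \<noteq> 0) \<and>
             c = vec (dim_row G) (\<lambda>j.
                   if j \<in> set B
                   then sgn (G $$ (hd B, l)) * (G $$ (j, l) div Gcd ((\<lambda>i. G $$ (i, l)) ` set B))
                   else 0))"

text \<open>
  A Gale transform \<open>G\<close> of \<open>A\<close>, a listing \<open>Bs\<close> of the bouquets (and, inside each of them,
  of its elements), and vectors \<open>cs\<close> attached to the listed bouquets.
\<close>

definition bouquet_data :: "int mat \<Rightarrow> int mat \<Rightarrow> nat list list \<Rightarrow> int vec list \<Rightarrow> bool" where
  "bouquet_data A G Bs cs \<longleftrightarrow>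
     gale_transform A G \<and>
     distinct (concat Bs) \<and> set ` set Bs = bouquets G \<and>
     length cs = length Bs \<and> (\<forall>i<length Bs. bouquet_vector G (Bs ! i) (cs ! i))"

text \<open>The columns of \<open>A\<^sub>B\<close> are the combinations \<open>A c\<close> of the columns of \<open>A\<close>.\<close>

definition bouquet_matrix :: "int mat \<Rightarrow> int vec list \<Rightarrow> int mat" where
  "bouquet_matrix A cs = mat_of_cols (dim_row A) (map (\<lambda>c. A *\<^sub>v c) cs)"

text \<open>\<open>D(u) = u\<^sub>0 c\<^sub>0 + ... + u\<^bsub>s-1\<^esub> c\<^bsub>s-1\<^esub>\<close>, a vector with as many entries as \<open>A\<close> has columns.\<close>

definition bouquet_map :: "int mat \<Rightarrow> int vec list \<Rightarrow> int vec \<Rightarrow> int vec" where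
  "bouquet_map A cs u = mat_of_cols (dim_col A) cs *\<^sub>v u"

definition simple_toric :: "int mat \<Rightarrow> bool" where
  "simple_toric T \<longleftrightarrow>
     (\<exists>G. gale_transform T G \<and> (\<forall>B \<in> bouquets G. is_singleton B))"

section \<open>The strongly robustness complex\<close>

definition robust_via ::
    "'k::field itself \<Rightarrow> int mat \<Rightarrow> nat set \<Rightarrow> int mat \<Rightarrow> int mat \<Rightarrow> nat list list \<Rightarrow> int vec list \<Rightarrow> bool"
  where
  "robust_via _ T \<omega> A G Bs cs \<longleftrightarrow>
     positively_graded A \<and> bouquet_data A G Bs cs \<and>
     length Bs = dim_col T \<and>
     (toric_ideal (bouquet_matrix A cs) :: 'k mpoly set) = toric_ideal T \<and>
     \<omega> = {i. i < length Bs \<and> non_mixed_bouquet G (set (Bs ! i))}"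

definition T_robust :: "'k::field itself \<Rightarrow> int mat \<Rightarrow> nat set \<Rightarrow> int mat \<Rightarrow> bool" where
  "T_robust K T \<omega> A \<longleftrightarrow> (\<exists>G Bs cs. robust_via K T \<omega> A G Bs cs)"

text \<open>
  The condition \<open>D(u) \<in> S(A)\<close> has the same truth value for all \<open>T\<^sub>\<omega>\<close>-robust toric ideals
  \<open>I\<^sub>A\<close>, so it is stated for some such ideal, of unrestricted size.
\<close>

definition S_omega :: "'k::field itself \<Rightarrow> int mat \<Rightarrow> nat set \<Rightarrow> int vec set" where
  "S_omega K T \<omega> =
     {u \<in> graver K T.
        \<exists>A G Bs cs. robust_via K T \<omega> A G Bs cs \<and> bouquet_map A cs u \<in> indispensable K A}"

definition robustness_complex :: "'k::field itself \<Rightarrow> int mat \<Rightarrow> nat set set" where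
  "robustness_complex K T = {\<omega>. \<omega> \<subseteq> {..<dim_col T} \<and> S_omega K T \<omega> = graver K T}"

end

theory Submission
  imports Defs
begin

text \<open>
  Both sides say that no Graver vector of \<open>T\<close> admits a certain kind of splitting, and that kind
  depends only on \<open>T\<close> and \<open>\<omega>\<close>.

  Call a kernel vector \<open>u\<close> of \<open>M\<close> split if \<open>u = w + y\<close> for nonzero kernel vectors with
  \<open>w\<^sup>+ \<le> u\<^sup>+\<close> (so that also \<open>y\<^sup>- \<le> u\<^sup>-\<close>). Then \<open>u\<^sup>+ - w\<close> is a third monomial in the fibre of
  \<open>x\<^bsup>u\<^sup>+\<^esup>\<close>, and conversely every third monomial comes from such a splitting. For a positively
  graded \<open>M\<close> and \<open>u \<noteq> 0\<close> in the kernel, \<open>u\<close> is indispensable iff it does not split. If \<open>u\<close>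
  splits, then \<open>binom u\<close> is a combination of \<open>binom w\<close> and \<open>binom y\<close>; each of these is generated
  by the Graver binomials conformally below it, and by positive grading \<open>\<plusminus>u\<close> is not among them
  (\<open>semiconformal_part_not_above\<close>). So the Graver binomials other than \<open>\<plusminus>binom u\<close> generate the
  ideal (\<open>toric_ideal_without_split_primitive\<close>), and, there being finitely many of them, they
  contain a minimal system of generators. If \<open>u\<close> does not split, the only binomials of the ideal of which
  some monomial multiple involves \<open>x\<^bsup>u\<^sup>+\<^esup>\<close> are \<open>\<plusminus>binom u\<close>, so the coefficient of \<open>x\<^bsup>u\<^sup>+\<^esup>\<close>
  vanishes on the ideal generated by all the others (\<open>unsplit_in_binomial_generators\<close>). The
  same two arguments show that \<open>I\<^sub>M\<close> is strongly robust iff no Graver vector splits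
  (\<open>strongly_robust_iff_unsplit\<close>).

  It remains to compare \<open>A\<close> with \<open>T\<close>. The map \<open>D\<close> is a bijection of kernels which repeats every
  coordinate of its argument along a bouquet, with nonzero factors. All factors are positive on a
  non-mixed bouquet, both signs occur on a mixed one, and on a free bouquet the coordinate of every
  kernel vector of \<open>T\<close> is zero (\<open>robust_via_signed_lift\<close>). Hence \<open>D\<close> preserves
  the conformal order and with it Graver vectors, while \<open>D(u)\<close> splits iff \<open>u\<close> splits by a \<open>w\<close>
  with the additional bound \<open>(-w\<^sub>i)\<^sup>+ \<le> (-u\<^sub>i)\<^sup>+\<close> for \<open>i \<notin> \<omega>\<close> (\<open>lift_splits_iff\<close>). As \<open>A\<close> does not
  occur in this condition, it decides strong robustness of \<open>I\<^sub>A\<close> and membership in \<open>S\<^sub>\<omega>(T)\<close> alike.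
\<close>

section \<open>Ideals of the polynomial ring\<close>

lemma poly_ring_simps [simp]:
  "p \<otimes>\<^bsub>poly_ring n\<^esub> q = p * q" "\<one>\<^bsub>poly_ring n\<^esub> = 1"
  "p \<oplus>\<^bsub>poly_ring n\<^esub> q = p + q" "\<zero>\<^bsub>poly_ring n\<^esub> = 0"
  by (simp_all add: poly_ring_def)

lemma carrier_poly_ring_iff:
  "p \<in> carrier (poly_ring n) \<longleftrightarrow> (\<forall>e \<in> Poly_Mapping.keys p. Poly_Mapping.keys e \<subseteq> {..<n})"
  by (simp add: poly_ring_def)

lemma carrier_zero: "0 \<in> carrier (poly_ring n)"
  and carrier_one: "1 \<in> carrier (poly_ring n)"
  by (simp_all add: carrier_poly_ring_iff)

lemma carrier_add:
  "p \<in> carrier (poly_ring n) \<Longrightarrow> q \<in> carrier (poly_ring n) \<Longrightarrow> p + q \<in> carrier (poly_ring n)"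
  using Poly_Mapping.keys_add[of p q] by (auto simp: carrier_poly_ring_iff)

lemma carrier_uminus: "p \<in> carrier (poly_ring n) \<Longrightarrow> - p \<in> carrier (poly_ring n)"
  by (simp add: carrier_poly_ring_iff in_keys_iff)

lemma carrier_mult:
  assumes "p \<in> carrier (poly_ring n)" "q \<in> carrier (poly_ring n)"
  shows "p * q \<in> carrier (poly_ring n)"
proof -
  have "Poly_Mapping.keys e \<subseteq> {..<n}" if e: "e \<in> Poly_Mapping.keys (p * q)" for e
  proof -
    obtain a b where "e = a + b" "a \<in> Poly_Mapping.keys p" "b \<in> Poly_Mapping.keys q"
      using e keys_mult[of p q] by blast
    then show ?thesis
      using assms Poly_Mapping.keys_add[of a b] by (force simp: carrier_poly_ring_iff)
  qed
  then show ?thesis by (simp add: carrier_poly_ring_iff)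
qed

lemma cring_poly_ring: "cring (poly_ring n :: 'k::field mpoly ring)"
proof (rule cringI)
  show "abelian_group (poly_ring n :: 'k mpoly ring)"
  proof (rule abelian_groupI)
    show "\<exists>y\<in>carrier (poly_ring n). y \<oplus>\<^bsub>poly_ring n\<^esub> x = \<zero>\<^bsub>poly_ring n\<^esub>"
      if "x \<in> carrier (poly_ring n)" for x :: "'k mpoly"
      using carrier_uminus[OF that] by (intro bexI[of _ "- x"]) simp_all
  qed (simp_all add: carrier_add carrier_zero ac_simps)
  show "Group.comm_monoid (poly_ring n :: 'k mpoly ring)"
    by (rule Group.comm_monoidI) (simp_all add: carrier_mult carrier_one ac_simps)
qed (simp add: distrib_right)

lemma carrier_single_iff:
  "Poly_Mapping.single e k \<in> carrier (poly_ring n) \<longleftrightarrow> k = 0 \<or> Poly_Mapping.keys e \<subseteq> {..<n}"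
  by (auto simp: carrier_poly_ring_iff split: if_splits)

lemma carrier_monomial:
  "Poly_Mapping.keys e \<subseteq> {..<n} \<Longrightarrow> monomial e \<in> carrier (poly_ring n)"
  unfolding monomial_def by (subst carrier_single_iff) simp

lemma poly_expansion:
  fixes p :: "'k::field mpoly"
  shows "p = (\<Sum>e\<in>Poly_Mapping.keys p. Poly_Mapping.single e (Poly_Mapping.lookup p e))"
  by (rule poly_mapping_eqI)
    (auto simp: lookup_sum lookup_single when_def in_keys_iff sum.delta[OF finite_keys])

text \<open>
  Every polynomial is a sum of terms, so closure under multiplication by terms is all that has to
  be checked.
\<close>

lemma ideal_poly_ringI:
  fixes J :: "'k::field mpoly set"
  assumes "J \<subseteq> carrier (poly_ring n)" "0 \<in> J"
    and add: "\<And>p q. p \<in> J \<Longrightarrow> q \<in> J \<Longrightarrow> p + q \<in> J"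
    and single: "\<And>p e k. p \<in> J \<Longrightarrow> Poly_Mapping.keys e \<subseteq> {..<n} \<Longrightarrow> Poly_Mapping.single e k * p \<in> J"
  shows "ideal J (poly_ring n)"
proof -
  interpret R: cring "poly_ring n :: 'k mpoly ring" by (rule cring_poly_ring)
  have sums: "sum f S \<in> J" if "finite S" "\<And>i. i \<in> S \<Longrightarrow> f i \<in> J"
    for f :: "_ \<Rightarrow> 'k mpoly" and S :: "(nat \<Rightarrow>\<^sub>0 nat) set"
    using that by (induction S rule: finite_induct) (auto intro: add assms(2))
  have mult: "q * p \<in> J" if "p \<in> J" "q \<in> carrier (poly_ring n)" for p q
  proof -
    have "q * p = (\<Sum>e\<in>Poly_Mapping.keys q. Poly_Mapping.single e (Poly_Mapping.lookup q e) * p)"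
      by (subst poly_expansion[of q]) (simp add: sum_distrib_right)
    also have "\<dots> \<in> J"
      using that by (intro sums single) (auto simp: carrier_poly_ring_iff)
    finally show ?thesis .
  qed
  have inv: "\<ominus>\<^bsub>poly_ring n\<^esub> p = - p" if "p \<in> carrier (poly_ring n)" for p :: "'k mpoly"
    by (rule R.minus_equality) (use that carrier_uminus[OF that] in auto)
  have neg: "- p \<in> J" if "p \<in> J" for p
    using mult[OF that carrier_uminus[OF carrier_one]] by simp
  have "subgroup J (add_monoid (poly_ring n))"
  proof (rule subgroup.intro)
    fix p assume "p \<in> J"
    then show "inv\<^bsub>add_monoid (poly_ring n)\<^esub> p \<in> J"
      using inv[of p] neg[of p] assms(1) unfolding a_inv_def by force
  qed (use assms in auto)
  then show ?thesis
    by (rule idealI[OF R.ring_axioms]) (use mult in \<open>auto simp: mult.commute\<close>)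
qed

context
  fixes n :: nat and X :: "'k::field mpoly set"
  assumes X: "X \<subseteq> carrier (poly_ring n)"
begin

lemma ideal_generated: "ideal (Idl\<^bsub>poly_ring n\<^esub> X) (poly_ring n)"
  using X cring_poly_ring ring.genideal_ideal cring.axioms(1) by blast

lemma generated_self: "X \<subseteq> Idl\<^bsub>poly_ring n\<^esub> X"
  using X cring_poly_ring ring.genideal_self cring.axioms(1) by blast

lemma generated_zero: "0 \<in> Idl\<^bsub>poly_ring n\<^esub> X"
  using additive_subgroup.zero_closed[OF ideal.axioms(1)[OF ideal_generated]] by simp

lemma generated_add:
  "p \<in> Idl\<^bsub>poly_ring n\<^esub> X \<Longrightarrow> q \<in> Idl\<^bsub>poly_ring n\<^esub> X \<Longrightarrow> p + q \<in> Idl\<^bsub>poly_ring n\<^esub> X"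
  using additive_subgroup.a_closed[OF ideal.axioms(1)[OF ideal_generated]] by force

lemma generated_mult:
  "p \<in> Idl\<^bsub>poly_ring n\<^esub> X \<Longrightarrow> q \<in> carrier (poly_ring n) \<Longrightarrow> q * p \<in> Idl\<^bsub>poly_ring n\<^esub> X"
  using ideal.I_l_closed[OF ideal_generated] by force

lemma generated_uminus: "p \<in> Idl\<^bsub>poly_ring n\<^esub> X \<Longrightarrow> - p \<in> Idl\<^bsub>poly_ring n\<^esub> X"
  using generated_mult[OF _ carrier_uminus[OF carrier_one]] by simp

lemma generated_monomial_mult:
  "p \<in> Idl\<^bsub>poly_ring n\<^esub> X \<Longrightarrow> Poly_Mapping.keys e \<subseteq> {..<n} \<Longrightarrow> monomial e * p \<in> Idl\<^bsub>poly_ring n\<^esub> X"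
  by (intro generated_mult carrier_monomial)

end

lemma generated_subset:
  fixes X :: "'k::field mpoly set"
  assumes "Y \<subseteq> carrier (poly_ring n)" "X \<subseteq> Idl\<^bsub>poly_ring n\<^esub> Y"
  shows "Idl\<^bsub>poly_ring n\<^esub> X \<subseteq> Idl\<^bsub>poly_ring n\<^esub> Y"
  using ring.genideal_minimal[OF cring.axioms(1)[OF cring_poly_ring] ideal_generated[OF assms(1)] assms(2)] .

section \<open>Binomials in an ideal generated by binomials\<close>

definition coeff_sum :: "(nat \<Rightarrow>\<^sub>0 nat) set \<Rightarrow> 'k::field mpoly \<Rightarrow> 'k" where
  "coeff_sum F p = (\<Sum>e\<in>Poly_Mapping.keys p. if e \<in> F then Poly_Mapping.lookup p e else 0)"

lemma coeff_sum_superset: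
  assumes "finite S" "Poly_Mapping.keys p \<subseteq> S"
  shows "coeff_sum F p = (\<Sum>e\<in>S. if e \<in> F then Poly_Mapping.lookup p e else 0)"
  unfolding coeff_sum_def by (rule sum.mono_neutral_left) (use assms in \<open>auto simp: in_keys_iff\<close>)

lemma coeff_sum_add: "coeff_sum F (p + q) = coeff_sum F p + coeff_sum F q"
proof -
  let ?S = "Poly_Mapping.keys p \<union> Poly_Mapping.keys q"
  have "coeff_sum F r = (\<Sum>e\<in>?S. if e \<in> F then Poly_Mapping.lookup r e else 0)"
    if "Poly_Mapping.keys r \<subseteq> ?S" for r :: "'a mpoly"
    by (rule coeff_sum_superset) (use that in simp_all)
  note S = this[of p] this[of q] this[of "p + q"]
  have "Poly_Mapping.keys (p + q) \<subseteq> ?S" by (rule Poly_Mapping.keys_add)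
  with S show ?thesis
    by (simp add: lookup_add sum.distrib[symmetric] if_distrib cong: if_cong)
qed

lemma coeff_sum_scale: "coeff_sum F (Poly_Mapping.single 0 k * p) = k * coeff_sum F p"
proof -
  have look: "Poly_Mapping.lookup (Poly_Mapping.single 0 k * p) e = k * Poly_Mapping.lookup p e" for e
    unfolding mult_map_scale_conv_mult[symmetric] by (simp add: Poly_Mapping.map.rep_eq when_def)
  have "coeff_sum F (Poly_Mapping.single 0 k * p)
      = (\<Sum>e\<in>Poly_Mapping.keys p. if e \<in> F then k * Poly_Mapping.lookup p e else 0)"
    by (subst coeff_sum_superset[of "Poly_Mapping.keys p"]) (auto simp: look in_keys_iff intro: sum.cong)
  then show ?thesis
    by (simp add: coeff_sum_def sum_distrib_left if_distrib cong: if_cong)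
qed

lemma coeff_sum_monomial: "coeff_sum F (monomial a) = (if a \<in> F then 1 else 0)"
  by (simp add: coeff_sum_def monomial_def)

lemma coeff_sum_diff: "coeff_sum F (p - q) = coeff_sum F p - coeff_sum F q"
  using coeff_sum_add[of F "p - q" q] by simp

lemma monomial_mult: "monomial a * monomial b = monomial (a + b)"
  by (simp add: monomial_def mult_single)

text \<open>
  The polynomials all of whose monomial multiples are killed by the functional form an ideal.
\<close>

lemma coeff_sum_generated:
  fixes X :: "'k::field mpoly set"
  assumes X: "X \<subseteq> carrier (poly_ring n)"
    and zero: "\<And>f c. f \<in> X \<Longrightarrow> coeff_sum F (monomial c * f) = 0"
    and p: "p \<in> Idl\<^bsub>poly_ring n\<^esub> X"
  shows "coeff_sum F p = 0"
proof -
  let ?J = "{p :: 'k mpoly. p \<in> carrier (poly_ring n) \<and> (\<forall>c. coeff_sum F (monomial c * p) = 0)}"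
  have "ideal ?J (poly_ring n)"
  proof (rule ideal_poly_ringI)
    fix p q :: "'k mpoly" assume "p \<in> ?J" "q \<in> ?J"
    then show "p + q \<in> ?J"
      using carrier_add[of p n q] by (simp add: distrib_left coeff_sum_add)
  next
    fix p :: "'k mpoly" and e :: "nat \<Rightarrow>\<^sub>0 nat" and k :: 'k
    assume p: "p \<in> ?J" and e: "Poly_Mapping.keys e \<subseteq> {..<n}"
    have shift: "monomial c * (Poly_Mapping.single e k * p) = Poly_Mapping.single 0 k * (monomial (c + e) * p)" for c
      by (simp add: mult.assoc[symmetric] mult_single monomial_def)
    have "Poly_Mapping.single e k * p \<in> carrier (poly_ring n)"
      using p e by (intro carrier_mult) (auto simp: carrier_single_iff)
    moreover have "coeff_sum F (monomial c * (Poly_Mapping.single e k * p)) = 0" for c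
      unfolding shift coeff_sum_scale using p by simp
    ultimately show "Poly_Mapping.single e k * p \<in> ?J" by simp
  qed (auto simp: coeff_sum_def carrier_zero)
  moreover have "X \<subseteq> ?J" using X zero by auto
  ultimately have "Idl\<^bsub>poly_ring n\<^esub> X \<subseteq> ?J"
    by (rule ring.genideal_minimal[OF cring.axioms(1)[OF cring_poly_ring]])
  then have "coeff_sum F (monomial 0 * p) = 0" using p by blast
  then show ?thesis by (simp add: monomial_def)
qed

text \<open>
  Consider the graph on exponents whose edges join the two exponents of each monomial multiple of a
  generator. If \<open>F\<close> is a union of connected components, the sum of the coefficients over \<open>F\<close>
  vanishes on the ideal, so no binomial of the ideal has exactly one exponent in \<open>F\<close>. Taking for
  \<open>F\<close> a fibre shows that binomials of a toric ideal come from the kernel; taking for \<open>F\<close> a single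
  exponent detects generators that cannot be dispensed with.
\<close>

lemma binomial_in_generated:
  fixes X :: "'k::field mpoly set"
  assumes X: "X \<subseteq> carrier (poly_ring n)"
    and sat: "\<And>f. f \<in> X \<Longrightarrow> \<exists>a b. f = monomial a - monomial b \<and> (\<forall>c. c + a \<in> F \<longleftrightarrow> c + b \<in> F)"
    and mem: "monomial p - monomial q \<in> Idl\<^bsub>poly_ring n\<^esub> X"
  shows "p \<in> F \<longleftrightarrow> q \<in> F"
proof -
  have "coeff_sum F (monomial c * f) = 0" if f: "f \<in> X" for f c
  proof -
    obtain a b where f: "f = monomial a - monomial b" and F: "\<And>c. c + a \<in> F \<longleftrightarrow> c + b \<in> F"
      using sat[OF f] by blast
    have "monomial c * f = monomial (c + a) - monomial (c + b)"
      by (simp add: f right_diff_distrib monomial_mult)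
    then show ?thesis by (simp add: coeff_sum_diff coeff_sum_monomial F)
  qed
  from coeff_sum_generated[OF X this mem] show ?thesis
    by (auto simp: coeff_sum_diff coeff_sum_monomial split: if_splits)
qed

text \<open>
  In characteristic 2 the exchanged pair is a genuine second possibility.
\<close>

lemma monomial_diff_eq:
  assumes "a \<noteq> b" "(monomial a - monomial b :: 'k::field mpoly) = monomial c - monomial d"
  shows "a = c \<and> b = d \<or> a = d \<and> b = c"
proof -
  have l: "Poly_Mapping.lookup (monomial a - monomial b :: 'k mpoly) e
         = Poly_Mapping.lookup (monomial c - monomial d) e" for e
    using assms by simp
  show ?thesis
    using l[of a] l[of b] assms(1)
    by (auto simp: monomial_def lookup_minus lookup_single when_def split: if_splits)
qed

lemma monomial_divides_iff:
  assumes b: "Poly_Mapping.keys b \<subseteq> {..<n}"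
  shows "(monomial a :: 'k::field mpoly) divides\<^bsub>poly_ring n\<^esub> monomial b
     \<longleftrightarrow> (\<forall>i. Poly_Mapping.lookup a i \<le> Poly_Mapping.lookup b i)"
proof
  assume "(monomial a :: 'k mpoly) divides\<^bsub>poly_ring n\<^esub> monomial b"
  then obtain c :: "'k mpoly" where "monomial b = monomial a * c"
    by (auto simp: factor_def)
  then have "b \<in> Poly_Mapping.keys (monomial a * c)"
    by (metis insertI1 keys_single monomial_def zero_neq_one)
  then obtain e where "b = a + e"
    using keys_mult[of "monomial a" c] by (auto simp: monomial_def)
  then show "\<forall>i. Poly_Mapping.lookup a i \<le> Poly_Mapping.lookup b i"
    by (simp add: lookup_add)
next
  assume le: "\<forall>i. Poly_Mapping.lookup a i \<le> Poly_Mapping.lookup b i"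
  have "Poly_Mapping.keys (b - a) \<subseteq> {..<n}"
    using b unfolding subset_iff in_keys_iff lookup_minus by (metis diff_0_eq_0)
  moreover have "a + (b - a) = b"
    using le by (intro poly_mapping_eqI) (simp add: lookup_add lookup_minus)
  ultimately show "(monomial a :: 'k mpoly) divides\<^bsub>poly_ring n\<^esub> monomial b"
    by (intro dividesI[of "monomial (b - a)"] carrier_monomial)
      (simp_all add: monomial_mult)
qed

section \<open>Binomials of lattice vectors\<close>

lemma lookup_pos_exp:
  "Poly_Mapping.lookup (pos_exp u) i = (if i < dim_vec u then nat (u $ i) else 0)"
  unfolding pos_exp_def by (auto simp: lookup_sum lookup_single when_def)

lemma lookup_neg_exp:
  "Poly_Mapping.lookup (neg_exp u) i = (if i < dim_vec u then nat (- (u $ i)) else 0)"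
  unfolding neg_exp_def by (auto simp: lookup_pos_exp)

lemma keys_pos_exp: "Poly_Mapping.keys (pos_exp u) \<subseteq> {..<dim_vec u}"
  and keys_neg_exp: "Poly_Mapping.keys (neg_exp u) \<subseteq> {..<dim_vec u}"
  by (auto simp: in_keys_iff lookup_pos_exp lookup_neg_exp split: if_splits)

lemma binom_uminus: "binom (- u) = - binom u"
  by (simp add: binom_def neg_exp_def)

lemma binom_zero: "binom (0\<^sub>v n) = 0"
proof -
  have "pos_exp (0\<^sub>v n) = neg_exp (0\<^sub>v n)"
    by (rule poly_mapping_eqI) (simp add: lookup_pos_exp lookup_neg_exp)
  then show ?thesis by (simp add: binom_def)
qed

lemma pos_exp_eq_iff:
  assumes "u \<in> carrier_vec n" "v \<in> carrier_vec n"
  shows "pos_exp u = pos_exp v \<and> neg_exp u = neg_exp v \<longleftrightarrow> u = v"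
proof
  assume "pos_exp u = pos_exp v \<and> neg_exp u = neg_exp v"
  then have "Poly_Mapping.lookup (pos_exp u) i = Poly_Mapping.lookup (pos_exp v) i"
    "Poly_Mapping.lookup (neg_exp u) i = Poly_Mapping.lookup (neg_exp v) i" for i
    by simp_all
  then have "u $ i = v $ i" if "i < n" for i
    using assms that by (simp add: lookup_pos_exp lookup_neg_exp) (smt (verit) nat_0_iff eq_nat_nat_iff)
  then show "u = v" using assms by auto
qed simp

lemma pos_exp_neq_neg_exp:
  assumes "u \<in> carrier_vec n" "u \<noteq> 0\<^sub>v n"
  shows "pos_exp u \<noteq> neg_exp u"
proof
  assume eq: "pos_exp u = neg_exp u"
  have "Poly_Mapping.lookup (pos_exp u) i = Poly_Mapping.lookup (neg_exp u) i" for i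
    using eq by simp
  then have "u $ i = 0" if "i < n" for i
    using assms(1) that by (simp add: lookup_pos_exp lookup_neg_exp) (smt (verit) nat_0_iff)
  then show False using assms by auto
qed

lemma binom_eq_iff:
  assumes u: "u \<in> carrier_vec n" "u \<noteq> 0\<^sub>v n" and v: "v \<in> carrier_vec n"
    and eq: "(binom u :: 'k::field mpoly) = binom v"
  shows "v = u \<or> v = - u"
proof -
  have "pos_exp u = pos_exp v \<and> neg_exp u = neg_exp v \<or> pos_exp u = neg_exp v \<and> neg_exp u = pos_exp v"
    using monomial_diff_eq[OF pos_exp_neq_neg_exp[OF u], where 'k = 'k] eq unfolding binom_def by blast
  then show ?thesis
  proof
    assume "pos_exp u = neg_exp v \<and> neg_exp u = pos_exp v"
    then have "pos_exp v = pos_exp (- u) \<and> neg_exp v = neg_exp (- u)"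
      by (simp add: neg_exp_def)
    then show ?thesis using pos_exp_eq_iff[of v n "- u"] u v by auto
  qed (use pos_exp_eq_iff[of u n v] u v in auto)
qed

lemma carrier_binom: "u \<in> carrier_vec n \<Longrightarrow> binom u \<in> carrier (poly_ring n)"
  unfolding binom_def diff_conv_add_uminus
  using keys_pos_exp[of u] keys_neg_exp[of u]
  by (intro carrier_add carrier_uminus carrier_monomial) auto

lemma mat_kernel_iff: "u \<in> mat_kernel M \<longleftrightarrow> u \<in> carrier_vec (dim_col M) \<and> M *\<^sub>v u = 0\<^sub>v (dim_row M)"
  by (simp add: mat_kernel_def)

lemma kernel_carrier: "u \<in> mat_kernel M \<Longrightarrow> u \<in> carrier_vec (dim_col M)"
  by (simp add: mat_kernel_iff)

lemma kernel_add: "u \<in> mat_kernel M \<Longrightarrow> v \<in> mat_kernel M \<Longrightarrow> u + v \<in> mat_kernel M"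
  by (auto simp: mat_kernel_iff mult_add_distrib_mat_vec[of M "dim_row M" "dim_col M"])

lemma kernel_uminus:
  fixes u :: "int vec"
  assumes "u \<in> mat_kernel M"
  shows "- u \<in> mat_kernel M"
proof -
  have "- u = (- 1) \<cdot>\<^sub>v u" by auto
  then show ?thesis using mat_kernel_smult[OF _ assms, of "dim_row M" "dim_col M" "- 1"] by simp
qed

lemma kernel_diff:
  fixes u :: "int vec"
  shows "u \<in> mat_kernel M \<Longrightarrow> v \<in> mat_kernel M \<Longrightarrow> u - v \<in> mat_kernel M"
  using kernel_add[OF _ kernel_uminus, of u M v] kernel_carrier[of u M] kernel_carrier[of v M]
  by (simp add: minus_add_uminus_vec[of u "dim_col M" v])

lemma diff_eq_zero_vec:
  fixes u v :: "int vec"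
  assumes "u \<in> carrier_vec n" "v \<in> carrier_vec n" "u - v = 0\<^sub>v n"
  shows "u = v"
proof (rule eq_vecI)
  fix i assume "i < dim_vec v"
  then have "i < n" "(u - v) $ i = 0\<^sub>v n $ i" using assms by auto
  then show "u $ i = v $ i" using assms(1,2) by simp
qed (use assms in simp)

lemma binoms_carrier:
  assumes "S \<subseteq> mat_kernel M"
  shows "binom ` S \<subseteq> carrier (poly_ring (dim_col M))"
  using assms carrier_binom kernel_carrier by blast

lemma binom_in_toric_ideal: "u \<in> mat_kernel M \<Longrightarrow> (binom u :: 'k::field mpoly) \<in> toric_ideal M"
  unfolding toric_ideal_def using generated_self[OF binoms_carrier[OF order.refl], of M] by blast

definition exp_vec :: "nat \<Rightarrow> (nat \<Rightarrow>\<^sub>0 nat) \<Rightarrow> int vec" where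
  "exp_vec n e = vec n (\<lambda>i. int (Poly_Mapping.lookup e i))"

lemma exp_vec_carrier [simp]: "exp_vec n e \<in> carrier_vec n"
  by (simp add: exp_vec_def)

lemma exp_vec_add: "exp_vec n (a + b) = exp_vec n a + exp_vec n b"
  by (auto simp: exp_vec_def lookup_add)

lemma exp_vec_pos_neg: "u \<in> carrier_vec n \<Longrightarrow> exp_vec n (pos_exp u) - exp_vec n (neg_exp u) = u"
  by (auto simp: exp_vec_def lookup_pos_exp lookup_neg_exp)

text \<open>
  The separating set \<open>F\<close> is the set of exponents of the same \<open>M\<close>-degree as \<open>a\<close>: multiples of
  generating binomials are homogeneous.
\<close>

lemma binomial_in_toric_ideal_kernel:
  assumes mem: "(monomial a - monomial b :: 'k::field mpoly) \<in> toric_ideal M"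
  shows "exp_vec (dim_col M) a - exp_vec (dim_col M) b \<in> mat_kernel M"
proof -
  let ?n = "dim_col M"
  have M: "M \<in> carrier_mat (dim_row M) ?n" by simp
  define F where "F = {e. M *\<^sub>v exp_vec ?n e = M *\<^sub>v exp_vec ?n a}"
  have "\<exists>a b. f = monomial a - monomial b \<and> (\<forall>c. c + a \<in> F \<longleftrightarrow> c + b \<in> F)"
    if f: "f \<in> binom ` mat_kernel M" for f :: "'k mpoly"
  proof -
    obtain u where u: "u \<in> mat_kernel M" and f: "f = binom u" using f by blast
    have "exp_vec ?n (pos_exp u) = exp_vec ?n (neg_exp u) + u"
      using exp_vec_pos_neg[of u ?n] kernel_carrier[OF u]
      by (auto simp: exp_vec_def lookup_pos_exp lookup_neg_exp)
    then have eq: "M *\<^sub>v exp_vec ?n (pos_exp u) = M *\<^sub>v exp_vec ?n (neg_exp u)"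
      using u mult_mat_vec_carrier[OF M, of "exp_vec ?n (neg_exp u)"]
      by (simp add: mult_add_distrib_mat_vec[OF M] mat_kernel_iff)
    have "c + pos_exp u \<in> F \<longleftrightarrow> c + neg_exp u \<in> F" for c
      by (simp add: F_def exp_vec_add mult_add_distrib_mat_vec[OF M] eq)
    then show ?thesis unfolding f binom_def by blast
  qed
  from binomial_in_generated[OF binoms_carrier[OF order.refl] this mem[unfolded toric_ideal_def]]
  have "a \<in> F \<longleftrightarrow> b \<in> F" .
  then have "M *\<^sub>v exp_vec ?n a = M *\<^sub>v exp_vec ?n b" by (simp add: F_def)
  then show ?thesis
    by (simp add: mat_kernel_iff mult_minus_distrib_mat_vec[OF M]
        minus_cancel_vec[OF mult_mat_vec_carrier[OF M exp_vec_carrier]])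
qed

lemma binom_in_toric_ideal_iff:
  assumes "u \<in> carrier_vec (dim_col M)"
  shows "(binom u :: 'k::field mpoly) \<in> toric_ideal M \<longleftrightarrow> u \<in> mat_kernel M"
  using binomial_in_toric_ideal_kernel[of "pos_exp u" "neg_exp u" M, where 'k = 'k]
    binom_in_toric_ideal[of u M] exp_vec_pos_neg[OF assms]
  unfolding binom_def by auto

section \<open>Graver vectors and the generation of the toric ideal\<close>

text \<open>
  As \<open>nat\<close> truncates, this is the divisibility of the monomials of \<open>binom u\<close> by those of
  \<open>binom w\<close> in the definition of primitivity.
\<close>

definition conformal_le :: "int vec \<Rightarrow> int vec \<Rightarrow> bool" where
  "conformal_le w u \<longleftrightarrow>
     (\<forall>i<dim_vec u. nat (w $ i) \<le> nat (u $ i) \<and> nat (- (w $ i)) \<le> nat (- (u $ i)))"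

definition primitive_kernel :: "int mat \<Rightarrow> int vec set" where
  "primitive_kernel M =
     {u \<in> mat_kernel M. u \<noteq> 0\<^sub>v (dim_col M) \<and>
        (\<forall>v \<in> mat_kernel M. conformal_le v u \<longrightarrow> v = 0\<^sub>v (dim_col M) \<or> v = u)}"

text \<open>
  Primitivity is a property of the lattice alone, so the Graver vectors do not depend on the field.
\<close>

lemma primitive_vec_iff:
  "primitive_vec (dim_col M) (toric_ideal M :: 'k::field mpoly set) u \<longleftrightarrow> u \<in> primitive_kernel M"
proof -
  have div: "(monomial (pos_exp v) :: 'k mpoly) divides\<^bsub>poly_ring (dim_col M)\<^esub> monomial (pos_exp u)
      \<and> (monomial (neg_exp v) :: 'k mpoly) divides\<^bsub>poly_ring (dim_col M)\<^esub> monomial (neg_exp u)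
      \<longleftrightarrow> conformal_le v u"
    if "u \<in> carrier_vec (dim_col M)" "v \<in> carrier_vec (dim_col M)" for v
    using that keys_pos_exp[of u] keys_neg_exp[of u]
    by (auto simp: monomial_divides_iff lookup_pos_exp lookup_neg_exp conformal_le_def)
  have "v \<in> carrier_vec (dim_col M) \<and> v \<noteq> 0\<^sub>v (dim_col M) \<and> v \<noteq> u \<and> (binom v :: 'k mpoly) \<in> toric_ideal M
      \<and> (monomial (pos_exp v) :: 'k mpoly) divides\<^bsub>poly_ring (dim_col M)\<^esub> monomial (pos_exp u)
      \<and> (monomial (neg_exp v) :: 'k mpoly) divides\<^bsub>poly_ring (dim_col M)\<^esub> monomial (neg_exp u)
    \<longleftrightarrow> v \<in> mat_kernel M \<and> v \<noteq> 0\<^sub>v (dim_col M) \<and> v \<noteq> u \<and> conformal_le v u"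
    if "u \<in> carrier_vec (dim_col M)" for v
    using div[OF that, of v] binom_in_toric_ideal_iff[of v M, where 'k = 'k] kernel_carrier[of v M] by blast
  then show ?thesis
    unfolding primitive_vec_def primitive_kernel_def Bex_def
    using binom_in_toric_ideal_iff[of u M, where 'k = 'k] kernel_carrier[of u M] by (cases "u \<in> carrier_vec (dim_col M)") auto
qed

lemma graver_eq: "graver TYPE('k::field) M = primitive_kernel M"
  by (auto simp: graver_def primitive_vec_iff)

lemma graver_basis_eq:
  "graver_basis (dim_col M) (toric_ideal M :: 'k::field mpoly set) = binom ` primitive_kernel M"
  by (auto simp: graver_basis_def primitive_vec_iff)

lemma primitive_kernelD:
  assumes "u \<in> primitive_kernel M"
  shows "u \<in> mat_kernel M" "u \<in> carrier_vec (dim_col M)" "u \<noteq> 0\<^sub>v (dim_col M)"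
  using assms by (auto simp: primitive_kernel_def mat_kernel_iff)

lemma conformal_le_uminus:
  "u \<in> carrier_vec n \<Longrightarrow> w \<in> carrier_vec n \<Longrightarrow> conformal_le (- w) (- u) \<longleftrightarrow> conformal_le w u"
  by (auto simp: conformal_le_def)

text \<open>
  Both summands pass through the monomial with exponent \<open>u\<^sup>+ - w = u\<^sup>- + y\<close>: the first one leads
  from \<open>u\<^sup>+\<close> to it, the second one from it to \<open>u\<^sup>-\<close>.
\<close>

lemma binom_split:
  assumes u: "u \<in> carrier_vec n" and w: "w \<in> carrier_vec n" and y: "y = u - w"
    and le: "\<And>i. i < n \<Longrightarrow> w $ i \<le> max 0 (u $ i)"
  shows "binom u = monomial (pos_exp u - pos_exp w) * binom w + monomial (neg_exp u - neg_exp y) * binom y"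
proof -
  have le': "w $ i \<le> max 0 (u $ i)" "y $ i = u $ i - w $ i" if "i < n" for i
    using that le u w by (simp_all add: y)
  have dim: "dim_vec u = n" "dim_vec w = n" "dim_vec y = n" using u w y by auto
  have 1: "nat x - nat z + nat z = nat x" "nat (- x) - nat (- t) + nat (- t) = nat (- x)"
    "nat x - nat z + nat (- z) = nat (- x) - nat (- t) + nat t"
    if "z \<le> max 0 x" "t = x - z" for x z t :: int
  proof -
    have pm: "int (nat r) - int (nat (- r)) = r" for r :: int by simp
    have le: "nat z \<le> nat x" "nat (- t) \<le> nat (- x)" using that by simp_all
    then show "nat x - nat z + nat z = nat x" "nat (- x) - nat (- t) + nat (- t) = nat (- x)" by simp_all
    have "int (nat x - nat z + nat (- z)) = int (nat (- x) - nat (- t) + nat t)"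
      unfolding of_nat_add of_nat_diff[OF le(1)] of_nat_diff[OF le(2)]
      using pm[of x] pm[of z] pm[of t] that(2) by linarith
    then show "nat x - nat z + nat (- z) = nat (- x) - nat (- t) + nat t" by linarith
  qed
  note look = lookup_add lookup_minus lookup_pos_exp lookup_neg_exp dim
  have 2: "pos_exp u - pos_exp w + pos_exp w = pos_exp u"
    by (rule poly_mapping_eqI) (auto simp: look 1[OF le'])
  have 3: "neg_exp u - neg_exp y + neg_exp y = neg_exp u"
    by (rule poly_mapping_eqI) (auto simp: look 1[OF le'])
  have 4: "pos_exp u - pos_exp w + neg_exp w = neg_exp u - neg_exp y + pos_exp y"
    by (rule poly_mapping_eqI) (auto simp: look 1[OF le'])
  show ?thesis
    by (simp add: binom_def right_diff_distrib monomial_mult 2 3 4)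
qed

definition norm1 :: "int vec \<Rightarrow> nat" where
  "norm1 u = (\<Sum>i<dim_vec u. nat \<bar>u $ i\<bar>)"

lemma conformal_le_trans:
  "dim_vec v = dim_vec u \<Longrightarrow> conformal_le w v \<Longrightarrow> conformal_le v u \<Longrightarrow> conformal_le w u"
  unfolding conformal_le_def by (metis order.trans)

lemma conformal_le_entry:
  fixes x z :: int
  assumes "nat z \<le> nat x" "nat (- z) \<le> nat (- x)"
  shows "z \<le> max 0 x" "nat (x - z) \<le> nat x" "nat (- (x - z)) \<le> nat (- x)"
    "nat \<bar>x\<bar> = nat \<bar>z\<bar> + nat \<bar>x - z\<bar>"
  using assms by (cases "0 \<le> x"; cases "0 \<le> z"; simp)+

lemma conformal_le_norm1:
  assumes "w \<in> carrier_vec n" "u \<in> carrier_vec n" "conformal_le w u"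
  shows "norm1 u = norm1 w + norm1 (u - w)"
proof -
  have "nat \<bar>u $ i\<bar> = nat \<bar>w $ i\<bar> + nat \<bar>(u - w) $ i\<bar>" if "i < n" for i
    using assms that conformal_le_entry(4)[of "w $ i" "u $ i"] by (simp add: conformal_le_def)
  then have "(\<Sum>i<n. nat \<bar>u $ i\<bar>) = (\<Sum>i<n. nat \<bar>w $ i\<bar> + nat \<bar>(u - w) $ i\<bar>)"
    by (intro sum.cong) blast+
  moreover have "dim_vec u = n" "dim_vec w = n" "dim_vec (u - w) = n"
    using assms by auto
  ultimately show ?thesis unfolding norm1_def by (simp only: sum.distrib)
qed

lemma norm1_eq_0: "u \<in> carrier_vec n \<Longrightarrow> norm1 u = 0 \<Longrightarrow> u = 0\<^sub>v n"
  by (auto simp: norm1_def)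

text \<open>
  A kernel vector that is not primitive is a conformal sum of two shorter ones, to which the
  induction hypothesis applies. That only primitive vectors below \<open>v\<close> are used is what later keeps
  a given primitive vector out of the generators.
\<close>

lemma binom_in_conformal_primitives:
  fixes v :: "int vec"
  assumes "v \<in> mat_kernel M"
  shows "(binom v :: 'k::field mpoly) \<in>
    Idl\<^bsub>poly_ring (dim_col M)\<^esub> (binom ` {g \<in> primitive_kernel M. conformal_le g v})"
  using assms
proof (induction "norm1 v" arbitrary: v rule: less_induct)
  case less
  let ?n = "dim_col M"
  let ?B = "\<lambda>v. binom ` {g \<in> primitive_kernel M. conformal_le g v} :: 'k mpoly set"
  have car: "?B v \<subseteq> carrier (poly_ring ?n)" for v
    by (rule binoms_carrier) (auto simp: primitive_kernel_def)
  note v = less.prems kernel_carrier[OF less.prems]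
  consider "v = 0\<^sub>v ?n" | "v \<in> primitive_kernel M"
    | w where "w \<in> mat_kernel M" "conformal_le w v" "w \<noteq> 0\<^sub>v ?n" "w \<noteq> v"
    using v by (auto simp: primitive_kernel_def)
  then show ?case
  proof cases
    case 1
    then show ?thesis using generated_zero[OF car] binom_zero by metis
  next
    case 2
    then show ?thesis
      using generated_self[OF car, of v] by (auto simp: conformal_le_def)
  next
    case (3 w)
    define y where "y = v - w"
    have w: "w \<in> carrier_vec ?n" and y: "y \<in> mat_kernel M" "y \<in> carrier_vec ?n"
      using 3 v kernel_carrier kernel_diff unfolding y_def by blast+
    have yv: "conformal_le y v"
      using 3(2) v(2) w by (auto simp: conformal_le_def y_def conformal_le_entry)
    have "y \<noteq> 0\<^sub>v ?n"
      using 3(4) diff_eq_zero_vec[OF v(2) w] unfolding y_def by blast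
    then have less': "norm1 w < norm1 v" "norm1 y < norm1 v"
      using conformal_le_norm1[OF w v(2) 3(2)] norm1_eq_0[OF w] norm1_eq_0[OF y(2)] 3(3)
      unfolding y_def by fastforce+
    have mono: "Idl\<^bsub>poly_ring ?n\<^esub> ?B x \<subseteq> Idl\<^bsub>poly_ring ?n\<^esub> ?B v"
      if "conformal_le x v" "x \<in> carrier_vec ?n" for x
      by (rule generated_subset[OF car])
        (use that v generated_self[OF car, of v] conformal_le_trans[of x v] in \<open>auto simp: image_subset_iff\<close>)
    have mem: "binom w \<in> Idl\<^bsub>poly_ring ?n\<^esub> ?B v" "binom y \<in> Idl\<^bsub>poly_ring ?n\<^esub> ?B v"
      using less.hyps[OF less'(1) 3(1)] less.hyps[OF less'(2) y(1)] mono[OF 3(2) w] mono[OF yv y(2)]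
      by blast+
    have keys: "Poly_Mapping.keys (pos_exp v - pos_exp w) \<subseteq> {..<?n}"
      "Poly_Mapping.keys (neg_exp v - neg_exp y) \<subseteq> {..<?n}"
      using v(2) w y by (auto simp: in_keys_iff lookup_minus lookup_pos_exp lookup_neg_exp split: if_splits)
    have eq: "binom v = monomial (pos_exp v - pos_exp w) * binom w + monomial (neg_exp v - neg_exp y) * binom y"
      by (rule binom_split[OF v(2) w y_def]) (use 3(2) v(2) in \<open>auto simp: conformal_le_def conformal_le_entry\<close>)
    show ?thesis
      unfolding eq
      by (rule generated_add[OF car generated_monomial_mult[OF car mem(1) keys(1)]
            generated_monomial_mult[OF car mem(2) keys(2)]])
  qed
qed

lemma toric_ideal_primitive:
  "(toric_ideal M :: 'k::field mpoly set) = Idl\<^bsub>poly_ring (dim_col M)\<^esub> (binom ` primitive_kernel M)"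
proof
  let ?P = "binom ` primitive_kernel M :: 'k mpoly set"
  have car: "?P \<subseteq> carrier (poly_ring (dim_col M))"
    by (rule binoms_carrier) (auto simp: primitive_kernel_def)
  have "binom v \<in> Idl\<^bsub>poly_ring (dim_col M)\<^esub> ?P" if "v \<in> mat_kernel M" for v
    using binom_in_conformal_primitives[OF that, where 'k = 'k]
      generated_subset[OF car, of "binom ` {g \<in> primitive_kernel M. conformal_le g v}"]
      generated_self[OF car] by blast
  then show "toric_ideal M \<subseteq> Idl\<^bsub>poly_ring (dim_col M)\<^esub> ?P"
    unfolding toric_ideal_def by (intro generated_subset[OF car]) blast
  show "Idl\<^bsub>poly_ring (dim_col M)\<^esub> ?P \<subseteq> toric_ideal M"
    unfolding toric_ideal_def
    by (intro generated_subset binoms_carrier)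
      (use binom_in_toric_ideal[of _ M] in \<open>auto simp: primitive_kernel_def toric_ideal_def\<close>)
qed

section \<open>Finiteness of the Graver basis\<close>

lemma nondecreasing_subsequence:
  fixes s :: "nat \<Rightarrow> nat"
  obtains \<phi> :: "nat \<Rightarrow> nat" where "strict_mono \<phi>" "\<And>i j. i \<le> j \<Longrightarrow> s (\<phi> i) \<le> s (\<phi> j)"
proof -
  obtain f where f: "strict_mono f" "monoseq (\<lambda>k. s (f k))"
    using seq_monosub[of s] by blast
  show thesis
  proof (cases "\<forall>i j. i \<le> j \<longrightarrow> s (f i) \<le> s (f j)")
    case True
    show ?thesis by (rule that[OF f(1)]) (use True in blast)
  next
    case False
    then have dec: "\<And>i j. i \<le> j \<Longrightarrow> s (f j) \<le> s (f i)"
      using f(2) unfolding monoseq_def by blast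
    obtain N where N: "\<And>k. s (f N) \<le> s (f k)"
      using ex_has_least_nat[of "\<lambda>_. True" 0 "\<lambda>k. s (f k)"] by blast
    have "s (f (N + i)) = s (f N)" for i
      using N[of "N + i"] dec[of N "N + i"] by simp
    moreover have "strict_mono (\<lambda>i. f (N + i))"
      using f(1) by (simp add: strict_mono_def)
    ultimately show ?thesis using that[of "\<lambda>i. f (N + i)"] by simp
  qed
qed

text \<open>
  Dickson's lemma, in the form that finitely many functions with values in the naturals become
  nondecreasing along a common subsequence.
\<close>

lemma dickson_subsequence:
  fixes s :: "nat \<Rightarrow> 'a" and H :: "('a \<Rightarrow> nat) set"
  assumes "finite H"
  shows "\<exists>\<phi> :: nat \<Rightarrow> nat. strict_mono \<phi> \<and> (\<forall>h\<in>H. \<forall>i j. i \<le> j \<longrightarrow> h (s (\<phi> i)) \<le> h (s (\<phi> j)))"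
  using assms
proof (induction H rule: finite_induct)
  case empty
  have "strict_mono (\<lambda>i::nat. i)" by (simp add: strict_mono_def)
  then show ?case by blast
next
  case (insert h H)
  from insert.IH obtain \<phi> :: "nat \<Rightarrow> nat"
    where \<phi>: "strict_mono \<phi>" "\<forall>h\<in>H. \<forall>i j. i \<le> j \<longrightarrow> h (s (\<phi> i)) \<le> h (s (\<phi> j))"
    by (elim exE conjE)
  obtain \<psi> :: "nat \<Rightarrow> nat" where \<psi>: "strict_mono \<psi>" "\<And>i j. i \<le> j \<Longrightarrow> h (s (\<phi> (\<psi> i))) \<le> h (s (\<phi> (\<psi> j)))"
    using nondecreasing_subsequence[of "\<lambda>i. h (s (\<phi> i))"] by metis
  have "strict_mono (\<phi> \<circ> \<psi>)" using \<phi>(1) \<psi>(1) by (simp add: strict_mono_o)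
  moreover have "h' (s ((\<phi> \<circ> \<psi>) i)) \<le> h' (s ((\<phi> \<circ> \<psi>) j))" if "h' \<in> insert h H" "i \<le> j" for h' i j
    using that \<phi>(2) \<psi>(2) strict_mono_less_eq[OF \<psi>(1)] by auto
  ultimately show ?case by blast
qed

text \<open>
  Distinct primitive vectors are incomparable for the conformal order, whereas an infinite sequence
  would have two comparable members.
\<close>

lemma finite_primitive_kernel: "finite (primitive_kernel M)"
proof (rule ccontr)
  assume inf: "infinite (primitive_kernel M)"
  obtain s :: "nat \<Rightarrow> int vec" where s: "inj s" "range s \<subseteq> primitive_kernel M"
    using infinite_countable_subset[OF inf] by (elim exE conjE)
  define H where "H = (\<lambda>i u. nat (u $ i :: int)) ` {..<dim_col M} \<union> (\<lambda>i u. nat (- (u $ i))) ` {..<dim_col M}"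
  have "finite H" by (simp add: H_def)
  obtain \<phi> :: "nat \<Rightarrow> nat" where \<phi>: "strict_mono \<phi>" "\<forall>h\<in>H. \<forall>i j. i \<le> j \<longrightarrow> h (s (\<phi> i)) \<le> h (s (\<phi> j))"
    using dickson_subsequence[OF \<open>finite H\<close>, of s] by (elim exE conjE)
  define u v where "u = s (\<phi> 0)" and "v = s (\<phi> 1)"
  have "u \<noteq> v"
    using strict_monoD[OF \<phi>(1), of 0 1] injD[OF s(1), of "\<phi> 0" "\<phi> 1"] unfolding u_def v_def by auto
  have uv: "u \<in> primitive_kernel M" "v \<in> primitive_kernel M"
    using s(2) unfolding u_def v_def by (simp_all add: image_subset_iff)
  have le: "h u \<le> h v" if "h \<in> H" for h
    using \<phi>(2) that unfolding u_def v_def by simp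
  have "conformal_le u v"
    unfolding conformal_le_def
  proof (intro allI impI)
    fix i assume "i < dim_vec v"
    then have "i < dim_col M" using primitive_kernelD(2)[OF uv(2)] by simp
    then have "(\<lambda>u. nat (u $ i)) \<in> H" "(\<lambda>u. nat (- (u $ i))) \<in> H" unfolding H_def by blast+
    from this[THEN le] show "nat (u $ i) \<le> nat (v $ i) \<and> nat (- (u $ i)) \<le> nat (- (v $ i))"
      by simp
  qed
  then show False
    using uv \<open>u \<noteq> v\<close> by (auto simp: primitive_kernel_def)
qed

section \<open>Semiconformal splittings and indispensability\<close>

text \<open>
  The second summand is \<open>u - w\<close>; the bound on \<open>w\<close> says that \<open>u\<^sup>+ - w\<close> has no negative
  entry, that is, that it is the exponent of a monomial.
\<close>

definition semiconformally_splits :: "int mat \<Rightarrow> int vec \<Rightarrow> bool" where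
  "semiconformally_splits M u \<longleftrightarrow>
     (\<exists>w \<in> mat_kernel M. w \<noteq> 0\<^sub>v (dim_col M) \<and> w \<noteq> u \<and> (\<forall>i<dim_col M. w $ i \<le> max 0 (u $ i)))"

lemma positively_gradedD:
  assumes "positively_graded M" "u \<in> mat_kernel M" "\<And>i. i < dim_col M \<Longrightarrow> 0 \<le> u $ i"
  shows "u = 0\<^sub>v (dim_col M)"
  using assms unfolding positively_graded_def by blast

text \<open>
  If \<open>u\<close> were conformally below \<open>w\<close>, then \<open>u - w\<close> would be a nonnegative kernel vector; if \<open>-u\<close>
  were, then \<open>u\<close> itself would be one.
\<close>

lemma semiconformal_part_not_above:
  assumes pos: "positively_graded M"
    and u: "u \<in> mat_kernel M" "u \<noteq> 0\<^sub>v (dim_col M)"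
    and w: "w \<in> mat_kernel M" "w \<noteq> u"
    and le: "\<And>i. i < dim_col M \<Longrightarrow> w $ i \<le> max 0 (u $ i)"
  shows "\<not> conformal_le u w" "\<not> conformal_le (- u) w"
proof -
  let ?n = "dim_col M"
  note car = kernel_carrier[OF u(1)] kernel_carrier[OF w(1)]
  show "\<not> conformal_le u w"
  proof
    assume c: "conformal_le u w"
    have "0 \<le> (u - w) $ i" if i: "i < ?n" for i
    proof -
      have "nat (u $ i) \<le> nat (w $ i)" "nat (- (u $ i)) \<le> nat (- (w $ i))"
        using c car i by (auto simp: conformal_le_def)
      then have "w $ i \<le> u $ i" using le[OF i] by linarith
      then show ?thesis using car i by simp
    qed
    then have "u - w = 0\<^sub>v ?n"
      by (intro positively_gradedD[OF pos kernel_diff[OF u(1) w(1)]])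
    then show False using diff_eq_zero_vec[OF car] w(2) by simp
  qed
  show "\<not> conformal_le (- u) w"
  proof
    assume c: "conformal_le (- u) w"
    have "0 \<le> u $ i" if i: "i < ?n" for i
    proof -
      have "nat (- (u $ i)) \<le> nat (w $ i)"
        using c car i by (auto simp: conformal_le_def)
      then show ?thesis using le[OF i] by linarith
    qed
    then show False using positively_gradedD[OF pos u(1)] u(2) by blast
  qed
qed

lemma uminus_eq_zero_vec_iff: "u \<in> carrier_vec n \<Longrightarrow> - u = 0\<^sub>v n \<longleftrightarrow> u = (0\<^sub>v n :: int vec)"
  by (metis uminus_uminus_vec uminus_zero_vec)

lemma primitive_binoms_carrier:
  "(binom ` (primitive_kernel M - S) :: 'k::field mpoly set) \<subseteq> carrier (poly_ring (dim_col M))"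
  by (rule binoms_carrier) (auto simp: primitive_kernel_def)

lemma split_binom_generated:
  assumes pos: "positively_graded M"
    and u: "u \<in> mat_kernel M" "u \<noteq> 0\<^sub>v (dim_col M)"
    and split: "semiconformally_splits M u"
  shows "(binom u :: 'k::field mpoly) \<in> Idl\<^bsub>poly_ring (dim_col M)\<^esub> (binom ` (primitive_kernel M - {u, - u}))"
proof -
  let ?n = "dim_col M" and ?X = "binom ` (primitive_kernel M - {u, - u}) :: 'k mpoly set"
  note car = primitive_binoms_carrier[of M "{u, - u}", where 'k = 'k]
  obtain w where w: "w \<in> mat_kernel M" "w \<noteq> 0\<^sub>v ?n" "w \<noteq> u"
    and le: "\<And>i. i < ?n \<Longrightarrow> w $ i \<le> max 0 (u $ i)"
    using split unfolding semiconformally_splits_def by blast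
  define y where "y = u - w"
  have y: "y \<in> mat_kernel M" unfolding y_def by (rule kernel_diff[OF u(1) w(1)])
  note vcar = kernel_carrier[OF u(1)] kernel_carrier[OF w(1)] kernel_carrier[OF y]
  \<comment> \<open>The other part is treated by symmetry: \<open>-y\<close> is a semiconformal part of \<open>-u\<close>.\<close>
  have "- y \<noteq> - u"
  proof
    assume "- y = - u"
    then have "u - w = u" using uminus_uminus_vec unfolding y_def by metis
    then have "(u - w) $ i = u $ i" for i by simp
    then have "u $ i - w $ i = u $ i" if "i < ?n" for i
      using vcar that by (metis carrier_vecD index_minus_vec(1))
    then have "w = 0\<^sub>v ?n"
      using vcar by (intro eq_vecI) auto
    then show False using w(2) by simp
  qed
  then have no: "\<not> conformal_le u w" "\<not> conformal_le (- u) w" "\<not> conformal_le (- u) (- y)" "\<not> conformal_le (- (- u)) (- y)"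
    using semiconformal_part_not_above[OF pos u w(1,3) le]
      semiconformal_part_not_above[OF pos kernel_uminus[OF u(1)] _ kernel_uminus[OF y]]
      vcar u(2) le by (force simp: uminus_eq_zero_vec_iff y_def)+
  then have no': "\<not> conformal_le u y" "\<not> conformal_le (- u) y"
    using conformal_le_uminus[of y ?n u] conformal_le_uminus[of y ?n "- u"] vcar by auto
  have gen: "(binom v :: 'k mpoly) \<in> Idl\<^bsub>poly_ring ?n\<^esub> ?X"
    if "v \<in> mat_kernel M" "\<not> conformal_le u v" "\<not> conformal_le (- u) v" for v
  proof -
    have "(binom ` {g \<in> primitive_kernel M. conformal_le g v} :: 'k mpoly set) \<subseteq> ?X"
      using that by (intro image_mono) auto
    then have "Idl\<^bsub>poly_ring ?n\<^esub> (binom ` {g \<in> primitive_kernel M. conformal_le g v}) \<subseteq> Idl\<^bsub>poly_ring ?n\<^esub> ?X"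
      using generated_self[OF car] by (intro generated_subset[OF car]) (rule order.trans)
    then show ?thesis using binom_in_conformal_primitives[OF that(1), where 'k = 'k] by blast
  qed
  have keys: "Poly_Mapping.keys (pos_exp u - pos_exp w) \<subseteq> {..<?n}"
    "Poly_Mapping.keys (neg_exp u - neg_exp y) \<subseteq> {..<?n}"
    using vcar by (auto simp: in_keys_iff lookup_minus lookup_pos_exp lookup_neg_exp split: if_splits)
  have eq: "binom u = monomial (pos_exp u - pos_exp w) * binom w + monomial (neg_exp u - neg_exp y) * binom y"
    by (rule binom_split[OF vcar(1,2) y_def]) (rule le)
  show ?thesis
    unfolding eq
    by (rule generated_add[OF car generated_monomial_mult[OF car gen[OF w(1) no(1,2)] keys(1)]
          generated_monomial_mult[OF car gen[OF y no'] keys(2)]])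
qed

lemma toric_ideal_without_split_primitive:
  assumes pos: "positively_graded M" and u: "u \<in> mat_kernel M" "u \<noteq> 0\<^sub>v (dim_col M)"
    and split: "semiconformally_splits M u"
  shows "(toric_ideal M :: 'k::field mpoly set) =
    Idl\<^bsub>poly_ring (dim_col M)\<^esub> (binom ` (primitive_kernel M - {u, - u}))"
proof
  let ?n = "dim_col M" and ?X = "binom ` (primitive_kernel M - {u, - u}) :: 'k mpoly set"
  note car = primitive_binoms_carrier[of M "{u, - u}", where 'k = 'k]
  note car0 = primitive_binoms_carrier[of M "{}", where 'k = 'k, simplified]
  have "binom u \<in> Idl\<^bsub>poly_ring ?n\<^esub> ?X" by (rule split_binom_generated[OF assms])
  moreover have "binom (- u) \<in> Idl\<^bsub>poly_ring ?n\<^esub> ?X"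
    unfolding binom_uminus by (rule generated_uminus[OF car calculation])
  ultimately have "binom ` primitive_kernel M \<subseteq> Idl\<^bsub>poly_ring ?n\<^esub> ?X"
    using generated_self[OF car] by blast
  then show "toric_ideal M \<subseteq> Idl\<^bsub>poly_ring ?n\<^esub> ?X"
    unfolding toric_ideal_primitive by (rule generated_subset[OF car])
  show "Idl\<^bsub>poly_ring ?n\<^esub> ?X \<subseteq> toric_ideal M"
    unfolding toric_ideal_primitive
    by (rule generated_subset[OF car0]) (use generated_self[OF car0] in blast)
qed

lemma binomial_carrier_keys:
  assumes "(monomial a - monomial b :: 'k::field mpoly) \<in> carrier (poly_ring n)" "a \<noteq> b"
  shows "Poly_Mapping.keys a \<subseteq> {..<n}" "Poly_Mapping.keys b \<subseteq> {..<n}"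
proof -
  have "a \<in> Poly_Mapping.keys (monomial a - monomial b :: 'k mpoly)"
    "b \<in> Poly_Mapping.keys (monomial a - monomial b :: 'k mpoly)"
    using assms(2) by (auto simp: in_keys_iff lookup_minus monomial_def lookup_single when_def)
  then show "Poly_Mapping.keys a \<subseteq> {..<n}" "Poly_Mapping.keys b \<subseteq> {..<n}"
    using assms(1) by (auto simp: carrier_poly_ring_iff)
qed

text \<open>
  A binomial \<open>x\<^sup>a - x\<^sup>b\<close> of the toric ideal with \<open>x\<^sup>a\<close> dividing \<open>x\<^bsup>u\<^sup>+\<^esup>\<close> provides the kernel vector
  \<open>w = a - b\<close>, which satisfies the bound of a splitting of \<open>u\<close>. If \<open>u\<close> does not split, this
  leaves \<open>w = u\<close>, and then \<open>a \<le> u\<^sup>+\<close> determines \<open>a\<close> and \<open>b\<close>.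
\<close>

lemma fibre_of_unsplit:
  assumes u: "u \<in> mat_kernel M" and unsplit: "\<not> semiconformally_splits M u"
    and keys: "Poly_Mapping.keys a \<subseteq> {..<dim_col M}" "Poly_Mapping.keys b \<subseteq> {..<dim_col M}"
    and ker: "exp_vec (dim_col M) a - exp_vec (dim_col M) b \<in> mat_kernel M"
    and le: "c + a = pos_exp u" and ne: "a \<noteq> b"
  shows "a = pos_exp u \<and> b = neg_exp u"
proof -
  let ?n = "dim_col M"
  define w where "w = exp_vec ?n a - exp_vec ?n b"
  note car = kernel_carrier[OF u]
  have w_i: "w $ i = int (Poly_Mapping.lookup a i) - int (Poly_Mapping.lookup b i)" if "i < ?n" for i
    using that by (simp add: w_def exp_vec_def)
  have a_i: "Poly_Mapping.lookup a i \<le> nat (u $ i)" if "i < ?n" for i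
    using that car arg_cong[OF le, of "\<lambda>e. Poly_Mapping.lookup e i"]
    by (simp add: lookup_add lookup_pos_exp)
  have outside: "Poly_Mapping.lookup a i = 0" "Poly_Mapping.lookup b i = 0" if "\<not> i < ?n" for i
    using keys that by (auto simp: in_keys_iff)
  have "w \<noteq> 0\<^sub>v ?n"
  proof
    assume "w = 0\<^sub>v ?n"
    then have "Poly_Mapping.lookup a i = Poly_Mapping.lookup b i" for i
      using w_i[of i] outside[of i] by (cases "i < ?n") auto
    then show False using ne poly_mapping_eqI by blast
  qed
  moreover have "w $ i \<le> max 0 (u $ i)" if "i < ?n" for i
    using w_i[OF that] a_i[OF that] by linarith
  ultimately have "w = u"
    using unsplit ker unfolding semiconformally_splits_def w_def by blast
  have entries: "Poly_Mapping.lookup a i = nat (u $ i) \<and> Poly_Mapping.lookup b i = nat (- (u $ i))" if "i < ?n" for i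
    using w_i[OF that] a_i[OF that] unfolding \<open>w = u\<close> by linarith
  have "Poly_Mapping.lookup a i = Poly_Mapping.lookup (pos_exp u) i"
    "Poly_Mapping.lookup b i = Poly_Mapping.lookup (neg_exp u) i" for i
    using entries[of i] outside[of i] car by (cases "i < ?n"; simp add: lookup_pos_exp lookup_neg_exp)+
  then show ?thesis using poly_mapping_eqI by blast
qed

text \<open>
  If neither \<open>binom u\<close> nor its negative were a generator, no multiple of a generator would
  contain the monomial \<open>x\<^bsup>u\<^sup>+\<^esup>\<close>, but \<open>binom u\<close> does.
\<close>

lemma unsplit_in_binomial_generators:
  fixes X :: "'k::field mpoly set"
  assumes u: "u \<in> mat_kernel M" "u \<noteq> 0\<^sub>v (dim_col M)" and unsplit: "\<not> semiconformally_splits M u"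
    and X: "X \<subseteq> carrier (poly_ring (dim_col M))" "\<And>f. f \<in> X \<Longrightarrow> is_binomial f"
    and gen: "Idl\<^bsub>poly_ring (dim_col M)\<^esub> X = toric_ideal M"
  shows "binom u \<in> X \<or> - binom u \<in> X"
proof (rule ccontr)
  assume no: "\<not> (binom u \<in> X \<or> - binom u \<in> X)"
  let ?n = "dim_col M"
  have "\<exists>a b. f = monomial a - monomial b \<and> (\<forall>c. c + a \<in> {pos_exp u} \<longleftrightarrow> c + b \<in> {pos_exp u})"
    if f: "f \<in> X" for f
  proof -
    obtain a b where ne: "a \<noteq> b" and f_eq: "f = monomial a - monomial b"
      using X(2)[OF f] unfolding is_binomial_def by blast
    have keys: "Poly_Mapping.keys a \<subseteq> {..<?n}" "Poly_Mapping.keys b \<subseteq> {..<?n}"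
      using binomial_carrier_keys[OF _ ne] X(1) f f_eq by blast+
    have mem: "f \<in> toric_ideal M" "- f \<in> toric_ideal M"
      using f generated_self[OF X(1)] generated_uminus[OF X(1)] gen by blast+
    have "exp_vec ?n a - exp_vec ?n b \<in> mat_kernel M" "exp_vec ?n b - exp_vec ?n a \<in> mat_kernel M"
      using binomial_in_toric_ideal_kernel[of a b M, where 'k = 'k]
        binomial_in_toric_ideal_kernel[of b a M, where 'k = 'k] mem
      by (auto simp: f_eq)
    note fib = fibre_of_unsplit[OF u(1) unsplit keys this(1) _ ne]
      fibre_of_unsplit[OF u(1) unsplit keys(2,1) this(2) _ ne[symmetric]]
    have "c + a \<noteq> pos_exp u" for c
      using fib(1)[of c] no f unfolding f_eq binom_def by auto
    moreover have "c + b \<noteq> pos_exp u" for c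
      using fib(2)[of c] no f unfolding f_eq binom_def by auto
    ultimately show ?thesis using f_eq by blast
  qed
  then have "pos_exp u \<in> {pos_exp u} \<longleftrightarrow> neg_exp u \<in> {pos_exp u}"
    by (rule binomial_in_generated[OF X(1)])
      (use binom_in_toric_ideal[OF u(1), where 'k = 'k] gen in \<open>simp_all add: binom_def\<close>)
  then show False
    using pos_exp_neq_neg_exp[OF kernel_carrier[OF u(1)] u(2)] by simp
qed

lemma finite_generators_contain_minimal:
  fixes X :: "'k::field mpoly set"
  assumes "finite X" "X \<subseteq> carrier (poly_ring n)"
  obtains Y where "Y \<subseteq> X" "minimal_generators n (Idl\<^bsub>poly_ring n\<^esub> X) Y"
proof -
  let ?P = "\<lambda>Y. Y \<subseteq> X \<and> Idl\<^bsub>poly_ring n\<^esub> Y = Idl\<^bsub>poly_ring n\<^esub> X"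
  obtain Y where Y: "?P Y" "\<And>Z. ?P Z \<Longrightarrow> card Y \<le> card Z"
    using ex_has_least_nat[of ?P X card] by blast
  have "Idl\<^bsub>poly_ring n\<^esub> Z \<noteq> Idl\<^bsub>poly_ring n\<^esub> X" if "Z \<subset> Y" for Z
    using Y(2)[of Z] Y(1) that psubset_card_mono[of Y Z] finite_subset[OF _ assms(1)] by fastforce
  then have "minimal_generators n (Idl\<^bsub>poly_ring n\<^esub> X) Y"
    using Y(1) assms(2) unfolding minimal_generators_def by auto
  then show thesis using that Y(1) by blast
qed

lemma binom_is_binomial:
  assumes "u \<in> carrier_vec n" "u \<noteq> 0\<^sub>v n"
  shows "is_binomial (binom u :: 'k::field mpoly)"
  using pos_exp_neq_neg_exp[OF assms] unfolding is_binomial_def binom_def by blast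

lemma primitive_is_binomial: "u \<in> primitive_kernel M \<Longrightarrow> is_binomial (binom u :: 'k::field mpoly)"
  using binom_is_binomial primitive_kernelD by blast

lemma binom_notin_without:
  assumes "u \<in> mat_kernel M" "u \<noteq> 0\<^sub>v (dim_col M)"
  shows "(binom u :: 'k::field mpoly) \<notin> binom ` (primitive_kernel M - {u, - u})"
    "- (binom u :: 'k mpoly) \<notin> binom ` (primitive_kernel M - {u, - u})"
proof -
  note u = kernel_carrier[OF assms(1)] assms(2)
  show "(binom u :: 'k mpoly) \<notin> binom ` (primitive_kernel M - {u, - u})"
    using binom_eq_iff[OF u, where 'k = 'k] primitive_kernelD(2)[of _ M] by blast
  have "- u \<in> carrier_vec (dim_col M)" "- u \<noteq> 0\<^sub>v (dim_col M)"
    using u by (auto simp: uminus_eq_zero_vec_iff)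
  from binom_eq_iff[OF this, where 'k = 'k]
  show "- (binom u :: 'k mpoly) \<notin> binom ` (primitive_kernel M - {u, - u})"
    using primitive_kernelD(2)[of _ M] unfolding binom_uminus by fastforce
qed

text \<open>
  For a vector that splits, a minimal system of binomial generators that avoids it has to be
  produced; it is found inside the finite Graver basis.
\<close>

lemma indispensable_iff_unsplit:
  assumes pos: "positively_graded M" and u: "u \<in> mat_kernel M" "u \<noteq> 0\<^sub>v (dim_col M)"
  shows "u \<in> indispensable TYPE('k::field) M \<longleftrightarrow> \<not> semiconformally_splits M u"
proof
  let ?n = "dim_col M" and ?X = "binom ` (primitive_kernel M - {u, - u}) :: 'k mpoly set"
  assume ind: "u \<in> indispensable TYPE('k) M"
  show "\<not> semiconformally_splits M u"
  proof
    assume "semiconformally_splits M u"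
    then have gen: "(toric_ideal M :: 'k mpoly set) = Idl\<^bsub>poly_ring ?n\<^esub> ?X"
      by (rule toric_ideal_without_split_primitive[OF pos u])
    have "finite ?X" using finite_primitive_kernel by blast
    then obtain Y where Y: "Y \<subseteq> ?X" "minimal_generators ?n (toric_ideal M) Y"
      using finite_generators_contain_minimal[OF _ primitive_binoms_carrier] unfolding gen by blast
    have "\<forall>f\<in>Y. is_binomial f" using Y(1) primitive_is_binomial by blast
    then have "binom u \<in> Y \<or> - binom u \<in> Y"
      using ind Y(2) unfolding indispensable_def by blast
    then show False using Y(1) binom_notin_without[OF u, where 'k = 'k] by blast
  qed
next
  assume unsplit: "\<not> semiconformally_splits M u"
  have "binom u \<in> X \<or> - binom u \<in> X"
    if "\<forall>f\<in>X. is_binomial f" "minimal_generators (dim_col M) (toric_ideal M) X" for X :: "'k mpoly set"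
    by (rule unsplit_in_binomial_generators[OF u unsplit]) (use that in \<open>auto simp: minimal_generators_def\<close>)
  then show "u \<in> indispensable TYPE('k) M"
    using u(1) by (simp add: indispensable_def)
qed

section \<open>Strong robustness\<close>

lemma sign_representatives_exist: "\<exists>R. sign_representatives X (R :: 'a::group_add set)"
proof -
  define rep where "rep f = (SOME g. g \<in> X \<and> (g = f \<or> g = - f))" for f
  have rep: "rep f \<in> X \<and> (rep f = f \<or> rep f = - f)" if "f \<in> X" for f
    unfolding rep_def by (rule someI[of _ f]) (use that in simp)
  have same: "rep f = rep g" if "g = f \<or> g = - f" for f g
  proof -
    have "(\<lambda>h. h \<in> X \<and> (h = f \<or> h = - f)) = (\<lambda>h. h \<in> X \<and> (h = g \<or> h = - g))"
      using that by (auto simp: fun_eq_iff)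
    then show ?thesis unfolding rep_def by simp
  qed
  have "\<exists>!g. g \<in> rep ` X \<and> (g = f \<or> g = - f)" if f: "f \<in> X" for f
  proof (rule ex1I[of _ "rep f"])
    show "rep f \<in> rep ` X \<and> (rep f = f \<or> rep f = - f)" using f rep by blast
    fix g assume g: "g \<in> rep ` X \<and> (g = f \<or> g = - f)"
    then obtain h where h: "h \<in> X" "g = rep h" by blast
    have "g = h \<or> g = - h" using rep[OF h(1)] h(2) by simp
    then have "rep h = rep g" by (rule same)
    moreover have "rep f = rep g" by (rule same) (use g in simp)
    ultimately show "g = rep f" using h(2) by simp
  qed
  then have "sign_representatives X (rep ` X)"
    using rep unfolding sign_representatives_def by auto
  then show ?thesis by blast
qed

lemma strongly_robust_unsplit:
  assumes pos: "positively_graded M" and robust: "strongly_robust TYPE('k::field) M"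
  shows "\<forall>u \<in> primitive_kernel M. \<not> semiconformally_splits M u"
proof -
  let ?n = "dim_col M" and ?G = "binom ` primitive_kernel M :: 'k mpoly set"
  note carG = primitive_binoms_carrier[of M "{}", where 'k = 'k, simplified]
  obtain R :: "'k mpoly set" where rep: "sign_representatives ?G R"
    and min: "minimal_generators ?n (toric_ideal M) R"
    using robust unfolding strongly_robust_def graver_basis_eq by blast
  then have R: "R \<subseteq> ?G" "\<And>f. f \<in> ?G \<Longrightarrow> \<exists>!g. g \<in> R \<and> (g = f \<or> g = - f)"
    unfolding sign_representatives_def by blast+
  show "\<forall>u \<in> primitive_kernel M. \<not> semiconformally_splits M u"
  proof (intro ballI notI)
    fix u assume u: "u \<in> primitive_kernel M" and split: "semiconformally_splits M u"
    note uk = primitive_kernelD(1,3)[OF u]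
    let ?X = "binom ` (primitive_kernel M - {u, - u}) :: 'k mpoly set"
    \<comment> \<open>The representative of the split vector is redundant, since the remaining ones generate.\<close>
    obtain f where f: "f \<in> R" "f = binom u \<or> f = - binom u" using R(2)[of "binom u"] u by blast
    have carR: "R - {f} \<subseteq> carrier (poly_ring ?n)" using R(1) carG by blast
    have "?X \<subseteq> Idl\<^bsub>poly_ring ?n\<^esub> (R - {f})"
    proof
      fix h assume h: "h \<in> ?X"
      then obtain g where g: "g \<in> R" "g = h \<or> g = - h" using R(2)[of h] by blast
      have "h \<noteq> binom u" "h \<noteq> - binom u"
        using h binom_notin_without[OF uk, where 'k = 'k] by blast+
      then have "g \<noteq> f" using f(2) g(2) by auto
      then have "g \<in> Idl\<^bsub>poly_ring ?n\<^esub> (R - {f})" using g(1) generated_self[OF carR] by blast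
      then show "h \<in> Idl\<^bsub>poly_ring ?n\<^esub> (R - {f})"
        using g(2) generated_uminus[OF carR] by fastforce
    qed
    then have "toric_ideal M \<subseteq> Idl\<^bsub>poly_ring ?n\<^esub> (R - {f})"
      unfolding toric_ideal_without_split_primitive[OF pos uk split] by (rule generated_subset[OF carR])
    moreover have "Idl\<^bsub>poly_ring ?n\<^esub> (R - {f}) \<subseteq> toric_ideal M"
      unfolding toric_ideal_primitive
      by (rule generated_subset[OF carG order.trans[OF _ generated_self[OF carG]]]) (use R(1) in blast)
    moreover have "Idl\<^bsub>poly_ring ?n\<^esub> (R - {f}) \<noteq> toric_ideal M"
      using min f(1) unfolding minimal_generators_def by blast
    ultimately show False by blast
  qed
qed

lemma unsplit_strongly_robust:
  assumes unsplit: "\<forall>u \<in> primitive_kernel M. \<not> semiconformally_splits M u"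
  shows "strongly_robust TYPE('k::field) M"
proof -
  let ?n = "dim_col M" and ?G = "binom ` primitive_kernel M :: 'k mpoly set"
  note carG = primitive_binoms_carrier[of M "{}", where 'k = 'k, simplified]
  obtain R where R: "sign_representatives ?G R" using sign_representatives_exist by blast
  then have R1: "R \<subseteq> ?G" and R2: "\<And>f. f \<in> ?G \<Longrightarrow> \<exists>!g. g \<in> R \<and> (g = f \<or> g = - f)"
    unfolding sign_representatives_def by blast+
  have carR: "R \<subseteq> carrier (poly_ring ?n)" using R1 carG by blast
  have "?G \<subseteq> Idl\<^bsub>poly_ring ?n\<^esub> R"
  proof
    fix f assume "f \<in> ?G"
    then obtain g where "g \<in> R" "g = f \<or> g = - f" using R2 by blast
    then show "f \<in> Idl\<^bsub>poly_ring ?n\<^esub> R"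
      using generated_self[OF carR] generated_uminus[OF carR] by fastforce
  qed
  then have "toric_ideal M \<subseteq> Idl\<^bsub>poly_ring ?n\<^esub> R"
    unfolding toric_ideal_primitive by (rule generated_subset[OF carR])
  moreover have "Idl\<^bsub>poly_ring ?n\<^esub> R \<subseteq> toric_ideal M"
    unfolding toric_ideal_primitive
    by (rule generated_subset[OF carG order.trans[OF R1 generated_self[OF carG]]])
  ultimately have genR: "Idl\<^bsub>poly_ring ?n\<^esub> R = toric_ideal M" by (rule antisym[rotated])
  have "Idl\<^bsub>poly_ring ?n\<^esub> Y \<noteq> toric_ideal M" if Y: "Y \<subset> R" for Y
  proof
    \<comment> \<open>A generating subset contains \<open>f\<close> or \<open>-f\<close>, and \<open>R\<close> contains only one of the two.\<close>
    assume gen: "Idl\<^bsub>poly_ring ?n\<^esub> Y = toric_ideal M"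
    obtain f where f: "f \<in> R" "f \<notin> Y" using Y by blast
    then obtain u where u: "u \<in> primitive_kernel M" "f = binom u" using R1 by blast
    have "Y \<subseteq> carrier (poly_ring ?n)" using Y carR by blast
    moreover have "is_binomial h" if "h \<in> Y" for h
      using that Y R1 primitive_is_binomial by blast
    ultimately have "f \<in> Y \<or> - f \<in> Y"
      unfolding u(2)
      using unsplit_in_binomial_generators[OF primitive_kernelD(1,3)[OF u(1)] _ _ _ gen] unsplit u(1)
      by blast
    then have "- f \<in> Y" using f(2) by blast
    then have "- f \<in> R" "- f \<noteq> f" using f(2) Y by (blast, metis)
    then show False using R2[of f] f(1) R1 by blast
  qed
  then have "minimal_generators ?n (toric_ideal M) R"
    unfolding minimal_generators_def using carR genR by simp
  then show "strongly_robust TYPE('k) M"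
    unfolding strongly_robust_def graver_basis_eq using R by blast
qed

lemma strongly_robust_iff_unsplit:
  assumes "positively_graded M"
  shows "strongly_robust TYPE('k::field) M \<longleftrightarrow> (\<forall>u \<in> primitive_kernel M. \<not> semiconformally_splits M u)"
  using strongly_robust_unsplit[OF assms] unsplit_strongly_robust by blast

section \<open>Kernel bijections that repeat coordinates with signs\<close>

lemma max_0_mult_pos: "0 < c \<Longrightarrow> c * w \<le> max 0 (c * u) \<longleftrightarrow> w \<le> max 0 u" for c w u :: int
  using max_mult_distrib_left[of c 0 u] mult_le_cancel_left_pos[of c w "max 0 u"] by simp

lemma max_0_mult_neg: "c < 0 \<Longrightarrow> c * w \<le> max 0 (c * u) \<longleftrightarrow> - w \<le> max 0 (- u)" for c w u :: int
  using max_0_mult_pos[of "- c" "- w" "- u"] by simp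

lemma conformal_le_iff:
  "conformal_le w u \<longleftrightarrow> (\<forall>i<dim_vec u. w $ i \<le> max 0 (u $ i) \<and> - (w $ i) \<le> max 0 (- (u $ i)))"
proof -
  have "nat z \<le> nat x \<longleftrightarrow> z \<le> max 0 x" for x z :: int by linarith
  then show ?thesis by (simp add: conformal_le_def)
qed

text \<open>
  The coordinates outside \<open>\<omega>\<close> are bounded on both sides, as in the conformal order; those in \<open>\<omega>\<close>
  only from above, as in a semiconformal splitting.
\<close>

definition splits_with_signs :: "int mat \<Rightarrow> nat set \<Rightarrow> int vec \<Rightarrow> bool" where
  "splits_with_signs T \<omega> u \<longleftrightarrow>
     (\<exists>w \<in> mat_kernel T. w \<noteq> 0\<^sub>v (dim_col T) \<and> w \<noteq> u \<and>
        (\<forall>i<dim_col T. w $ i \<le> max 0 (u $ i) \<and> (i \<notin> \<omega> \<longrightarrow> - (w $ i) \<le> max 0 (- (u $ i)))))"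

text \<open>
  What the bouquet map does to kernel vectors: position \<open>j\<close> of \<open>D u\<close> is a copy of coordinate
  \<open>\<beta> j\<close> of \<open>u\<close>, scaled by \<open>c j\<close>. Only the signs of the scaling factors matter. The second alternative for
  coordinates outside \<open>\<omega>\<close> accommodates free bouquets.
\<close>

locale signed_lift =
  fixes T A :: "int mat" and \<omega> :: "nat set" and D :: "int vec \<Rightarrow> int vec"
    and \<beta> :: "nat \<Rightarrow> nat" and c :: "nat \<Rightarrow> int"
  assumes index_range: "\<And>j. j < dim_col A \<Longrightarrow> \<beta> j < dim_col T"
    and factor_nonzero: "\<And>j. j < dim_col A \<Longrightarrow> c j \<noteq> 0"
    and lift_def: "\<And>u. u \<in> carrier_vec (dim_col T) \<Longrightarrow> D u = vec (dim_col A) (\<lambda>j. c j * u $ \<beta> j)"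
    and lift_bij: "bij_betw D (mat_kernel T) (mat_kernel A)"
    and positive_copy: "\<And>i. i < dim_col T \<Longrightarrow> \<exists>j<dim_col A. \<beta> j = i \<and> 0 < c j"
    and positive: "\<And>j. j < dim_col A \<Longrightarrow> \<beta> j \<in> \<omega> \<Longrightarrow> 0 < c j"
    and negative_copy: "\<And>i. i < dim_col T \<Longrightarrow> i \<notin> \<omega> \<Longrightarrow>
      (\<exists>j<dim_col A. \<beta> j = i \<and> c j < 0) \<or> (\<forall>w \<in> mat_kernel T. w $ i = 0)"
begin

lemma lift_kernel: "u \<in> mat_kernel T \<Longrightarrow> D u \<in> mat_kernel A"
  using lift_bij bij_betwE by blast

lemma lift_surj: "v \<in> mat_kernel A \<Longrightarrow> \<exists>w \<in> mat_kernel T. v = D w"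
  using lift_bij unfolding bij_betw_def by blast

lemma lift_eq_iff: "u \<in> mat_kernel T \<Longrightarrow> w \<in> mat_kernel T \<Longrightarrow> D u = D w \<longleftrightarrow> u = w"
  using lift_bij unfolding bij_betw_def inj_on_def by blast

lemma lift_eq_zero_iff:
  assumes "u \<in> mat_kernel T"
  shows "D u = 0\<^sub>v (dim_col A) \<longleftrightarrow> u = 0\<^sub>v (dim_col T)"
proof -
  have "0\<^sub>v (dim_col T) \<in> mat_kernel T" by (auto simp: mat_kernel_iff)
  moreover have "D (0\<^sub>v (dim_col T)) = 0\<^sub>v (dim_col A)"
    using index_range by (auto simp: lift_def)
  ultimately show ?thesis using lift_eq_iff[OF assms] by metis
qed

lemma conformal_le_lift_iff:
  assumes u: "u \<in> carrier_vec (dim_col T)" and w: "w \<in> carrier_vec (dim_col T)"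
  shows "conformal_le (D w) (D u) \<longleftrightarrow> conformal_le w u"
proof -
  let ?le = "\<lambda>x y :: int. x \<le> max 0 y \<and> - x \<le> max 0 (- y)"
  have entry: "?le (c j * w $ \<beta> j) (c j * u $ \<beta> j) \<longleftrightarrow> ?le (w $ \<beta> j) (u $ \<beta> j)" if "j < dim_col A" for j
    using factor_nonzero[OF that] max_0_mult_pos[of "c j"] max_0_mult_neg[of "c j"]
      max_0_mult_pos[of "- c j" "w $ \<beta> j" "u $ \<beta> j"] max_0_mult_neg[of "- c j" "w $ \<beta> j" "u $ \<beta> j"]
    by (cases "0 < c j") auto
  have "conformal_le (D w) (D u) \<longleftrightarrow> (\<forall>j<dim_col A. ?le (w $ \<beta> j) (u $ \<beta> j))"
    using entry by (simp add: conformal_le_iff lift_def u w)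
  also have "\<dots> \<longleftrightarrow> (\<forall>i<dim_col T. ?le (w $ i) (u $ i))"
    using index_range positive_copy by metis
  finally show ?thesis using u by (simp add: conformal_le_iff)
qed

text \<open>
  The conformal order treats both signs alike, so scaling by nonzero factors of any sign preserves it.
\<close>

lemma lift_primitive_iff:
  assumes u: "u \<in> mat_kernel T"
  shows "D u \<in> primitive_kernel A \<longleftrightarrow> u \<in> primitive_kernel T"
proof -
  have "(\<forall>v \<in> mat_kernel A. conformal_le v (D u) \<longrightarrow> v = 0\<^sub>v (dim_col A) \<or> v = D u)
    \<longleftrightarrow> (\<forall>w \<in> mat_kernel T. conformal_le (D w) (D u) \<longrightarrow> D w = 0\<^sub>v (dim_col A) \<or> D w = D u)"
    using lift_surj lift_kernel by metis
  also have "\<dots> \<longleftrightarrow> (\<forall>w \<in> mat_kernel T. conformal_le w u \<longrightarrow> w = 0\<^sub>v (dim_col T) \<or> w = u)"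
    using conformal_le_lift_iff[OF kernel_carrier[OF u] kernel_carrier] lift_eq_zero_iff lift_eq_iff[OF _ u]
    by simp
  finally show ?thesis
    unfolding primitive_kernel_def using u lift_kernel[OF u] lift_eq_zero_iff[OF u] by simp
qed

lemma primitive_kernel_lift: "primitive_kernel A = D ` primitive_kernel T"
proof
  show "primitive_kernel A \<subseteq> D ` primitive_kernel T"
    using lift_surj lift_primitive_iff primitive_kernelD(1) by (metis image_eqI subsetI)
  show "D ` primitive_kernel T \<subseteq> primitive_kernel A"
    using lift_primitive_iff primitive_kernelD(1) by blast
qed

text \<open>
  A positive copy of a coordinate imposes the upper bound on it, a negative copy imposes the same
  bound on its negative, and where all kernel vectors vanish every bound holds.
\<close>

lemma lift_splits_iff:
  assumes u: "u \<in> mat_kernel T"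
  shows "semiconformally_splits A (D u) \<longleftrightarrow> splits_with_signs T \<omega> u"
proof -
  have le: "(\<forall>j<dim_col A. D w $ j \<le> max 0 (D u $ j)) \<longleftrightarrow>
      (\<forall>i<dim_col T. w $ i \<le> max 0 (u $ i) \<and> (i \<notin> \<omega> \<longrightarrow> - (w $ i) \<le> max 0 (- (u $ i))))"
    (is "?L \<longleftrightarrow> ?R") if w: "w \<in> mat_kernel T" for w
  proof -
    have L: "?L \<longleftrightarrow> (\<forall>j<dim_col A. c j * w $ \<beta> j \<le> max 0 (c j * u $ \<beta> j))"
      by (simp add: lift_def kernel_carrier[OF u] kernel_carrier[OF w])
    show ?thesis
    proof
      assume ?L
      then have le: "c j * w $ \<beta> j \<le> max 0 (c j * u $ \<beta> j)" if "j < dim_col A" for j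
        using L that by blast
      show ?R
      proof (intro allI impI conjI)
        fix i assume i: "i < dim_col T"
        obtain j where "j < dim_col A" "\<beta> j = i" "0 < c j" using positive_copy[OF i] by blast
        then show "w $ i \<le> max 0 (u $ i)" using le[of j] max_0_mult_pos[of "c j"] by simp
        assume "i \<notin> \<omega>"
        then consider j where "j < dim_col A" "\<beta> j = i" "c j < 0" | "w $ i = 0"
          using negative_copy[OF i] w by blast
        then show "- (w $ i) \<le> max 0 (- (u $ i))"
        proof cases
          case (1 j)
          then show ?thesis using le[of j] max_0_mult_neg[of "c j"] by simp
        qed simp
      qed
    next
      assume R: ?R
      have "c j * w $ \<beta> j \<le> max 0 (c j * u $ \<beta> j)" if j: "j < dim_col A" for j
      proof (cases "0 < c j")
        case True
        then show ?thesis using R index_range[OF j] max_0_mult_pos by blast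
      next
        case False
        then have "c j < 0" "\<beta> j \<notin> \<omega>" using factor_nonzero[OF j] positive[OF j] by force+
        then show ?thesis using R index_range[OF j] max_0_mult_neg by blast
      qed
      then show ?L using L by blast
    qed
  qed
  have "semiconformally_splits A (D u) \<longleftrightarrow>
      (\<exists>w \<in> mat_kernel T. D w \<noteq> 0\<^sub>v (dim_col A) \<and> D w \<noteq> D u \<and> (\<forall>j<dim_col A. D w $ j \<le> max 0 (D u $ j)))"
    unfolding semiconformally_splits_def bij_betw_imp_surj_on[OF lift_bij, symmetric] by simp
  then show ?thesis
    unfolding splits_with_signs_def using le lift_eq_zero_iff lift_eq_iff[OF _ u] by simp
qed

lemma lift_indispensable_iff:
  assumes "positively_graded A" "u \<in> primitive_kernel T"
  shows "D u \<in> indispensable TYPE('k::field) A \<longleftrightarrow> \<not> splits_with_signs T \<omega> u"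
proof -
  note u = primitive_kernelD[OF assms(2)]
  have "D u \<noteq> 0\<^sub>v (dim_col A)" using lift_eq_zero_iff[OF u(1)] u(3) by simp
  then show ?thesis
    using indispensable_iff_unsplit[OF assms(1) lift_kernel[OF u(1)], where 'k = 'k] lift_splits_iff[OF u(1)]
    by simp
qed

lemma strongly_robust_iff_no_signed_split:
  assumes "positively_graded A"
  shows "strongly_robust TYPE('k::field) A \<longleftrightarrow> (\<forall>u \<in> primitive_kernel T. \<not> splits_with_signs T \<omega> u)"
  unfolding strongly_robust_iff_unsplit[OF assms] primitive_kernel_lift
  using lift_splits_iff primitive_kernelD(1) by blast

end

section \<open>Bouquets of a Gale transform\<close>

definition proportional_rows :: "int mat \<Rightarrow> nat \<Rightarrow> nat \<Rightarrow> rat \<Rightarrow> bool" where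
  "proportional_rows G i j q \<longleftrightarrow> (\<forall>l<dim_col G. rat_of_int (G $$ (i, l)) = q * rat_of_int (G $$ (j, l)))"

lemma rat_row_eq_iff:
  assumes "i < dim_row G" "j < dim_row G"
  shows "rat_row G i = q \<cdot>\<^sub>v rat_row G j \<longleftrightarrow> proportional_rows G i j q"
  using assms by (auto simp: rat_row_def proportional_rows_def vec_eq_iff)

text \<open>
  Mutual proportionality amounts to proportionality by a nonzero factor; for two zero rows the
  factor 1 serves.
\<close>

lemma bouquet_edges_iff:
  "(i, j) \<in> bouquet_edges G \<longleftrightarrow>
     i < dim_row G \<and> j < dim_row G \<and> i \<noteq> j \<and> (\<exists>q. q \<noteq> 0 \<and> proportional_rows G i j q)"
proof -
  have "(\<exists>q. proportional_rows G i j q) \<and> (\<exists>q. proportional_rows G j i q)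
    \<longleftrightarrow> (\<exists>q. q \<noteq> 0 \<and> proportional_rows G i j q)" (is "?L \<longleftrightarrow> ?R")
  proof
    assume ?L
    then obtain q r where qr: "proportional_rows G i j q" "proportional_rows G j i r" by blast
    show ?R
    proof (cases "q = 0")
      case True
      then have "proportional_rows G i j 1" using qr by (simp add: proportional_rows_def)
      then show ?thesis using zero_neq_one by metis
    qed (use qr in blast)
  next
    assume ?R
    then obtain q where q: "q \<noteq> 0" "proportional_rows G i j q" by blast
    then have "proportional_rows G j i (1 / q)" by (simp add: proportional_rows_def)
    then show ?L using q by blast
  qed
  then show ?thesis
    unfolding bouquet_edges_def using rat_row_eq_iff[of i G j] rat_row_eq_iff[of j G i]
    by (cases "i < dim_row G \<and> j < dim_row G") auto
qed

lemma bouquet_path_proportional: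
  assumes "(i, j) \<in> (bouquet_edges G)\<^sup>*"
  shows "\<exists>q. q \<noteq> 0 \<and> proportional_rows G i j q"
  using assms
proof (induction rule: rtrancl_induct)
  case base
  have "proportional_rows G i i 1" by (simp add: proportional_rows_def)
  then show ?case using zero_neq_one by metis
next
  case (step y z)
  then obtain q r where "q \<noteq> 0" "proportional_rows G i y q" "r \<noteq> 0" "proportional_rows G y z r"
    by (auto simp: bouquet_edges_iff)
  then have "q * r \<noteq> 0" "proportional_rows G i z (q * r)" by (simp_all add: proportional_rows_def)
  then show ?case by blast
qed

lemma sym_bouquet_edges: "sym (bouquet_edges G)"
  by (auto simp: sym_def bouquet_edges_def)

lemma bouquet_path_range:
  assumes "(i, j) \<in> (bouquet_edges G)\<^sup>*" "i < dim_row G"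
  shows "j < dim_row G"
  using assms by (induction rule: rtrancl_induct) (auto simp: bouquet_edges_iff)

text \<open>
  Proportionality by a nonzero factor is transitive, so it holds throughout a connected component.
\<close>

lemma bouquetD:
  assumes "B \<in> bouquets G"
  shows "B \<noteq> {}" "B \<subseteq> {..<dim_row G}"
    "\<And>i j. i \<in> B \<Longrightarrow> j \<in> B \<Longrightarrow> \<exists>q. q \<noteq> 0 \<and> proportional_rows G i j q"
proof -
  obtain x where x: "x < dim_row G" "B = (bouquet_edges G)\<^sup>* `` {x}"
    using assms unfolding bouquets_def by (auto elim: quotientE)
  show "B \<noteq> {}" using x by auto
  show "B \<subseteq> {..<dim_row G}" using x bouquet_path_range by auto
  fix i j assume "i \<in> B" "j \<in> B"
  then have "(x, i) \<in> (bouquet_edges G)\<^sup>*" "(x, j) \<in> (bouquet_edges G)\<^sup>*" using x by auto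
  then have "(i, j) \<in> (bouquet_edges G)\<^sup>*"
    using sym_rtrancl[OF sym_bouquet_edges] by (meson rtrancl_trans symD)
  then show "\<exists>q. q \<noteq> 0 \<and> proportional_rows G i j q" by (rule bouquet_path_proportional)
qed

lemma bouquets_cover: "j < dim_row G \<Longrightarrow> \<exists>B \<in> bouquets G. j \<in> B"
  unfolding bouquets_def by (intro bexI[of _ "(bouquet_edges G)\<^sup>* `` {j}"]) (auto intro: quotientI)

text \<open>
  Kernel vectors are combinations of the columns of \<open>G\<close>, so relations between the rows of \<open>G\<close> hold
  between the entries of kernel vectors.
\<close>

lemma kernel_entries_proportional:
  assumes gale: "gale_transform A G" and v: "v \<in> mat_kernel A"
    and ij: "i < dim_col A" "j < dim_col A" and q: "proportional_rows G i j q"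
  shows "rat_of_int (v $ i) = q * rat_of_int (v $ j)"
proof -
  have dim: "dim_row G = dim_col A" using gale by (simp add: gale_transform_def)
  obtain w where w: "w \<in> carrier_vec (dim_col G)" "v = G *\<^sub>v w"
    using gale v unfolding gale_transform_def bij_betw_def by blast
  have entry: "rat_of_int (v $ k) = (\<Sum>l<dim_col G. rat_of_int (G $$ (k, l)) * rat_of_int (w $ l))"
    if "k < dim_col A" for k
    using that w dim by (simp add: scalar_prod_def lessThan_atLeast0)
  show ?thesis
    using q unfolding entry[OF ij(1)] entry[OF ij(2)]
    by (auto simp: proportional_rows_def sum_distrib_left mult.assoc intro!: sum.cong)
qed

lemma kernel_entry_of_free:
  assumes gale: "gale_transform A G" and v: "v \<in> mat_kernel A"
    and j: "j < dim_col A" "row G j = 0\<^sub>v (dim_col G)"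
  shows "v $ j = 0"
proof -
  have dim: "dim_row G = dim_col A" using gale by (simp add: gale_transform_def)
  obtain w where w: "w \<in> carrier_vec (dim_col G)" "v = G *\<^sub>v w"
    using gale v unfolding gale_transform_def bij_betw_def by blast
  then show ?thesis using j dim by simp
qed

text \<open>
  The primitive integer vector on a rational line generates the integer points of that line. It
  suffices that the single entry \<open>m h\<close> divides every \<open>m j * v h\<close>, hence \<open>v h\<close> times the gcd.
\<close>

lemma common_factor_of_proportional:
  fixes m v :: "'a \<Rightarrow> int"
  assumes h: "h \<in> B" "m h \<noteq> 0" and cross: "\<And>j. j \<in> B \<Longrightarrow> m h * v j = m j * v h"
  shows "\<exists>t. \<forall>j\<in>B. v j = t * (m j div Gcd (m ` B))"
proof -
  let ?g = "Gcd (m ` B)"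
  have "m h dvd Gcd ((*) (v h) ` (m ` B))"
  proof (rule Gcd_greatest)
    fix b assume "b \<in> (*) (v h) ` (m ` B)"
    then obtain j where "j \<in> B" "b = m h * v j" using cross by (auto simp: mult.commute)
    then show "m h dvd b" by simp
  qed
  then have "m h dvd v h * ?g" by (simp add: Gcd_mult)
  then obtain t where t: "v h * ?g = m h * t" by (elim dvdE)
  have "v j = t * (m j div ?g)" if j: "j \<in> B" for j
  proof -
    have g: "?g dvd m j" "?g dvd m h" using j h by auto
    then have "?g \<noteq> 0" using h(2) by auto
    have "m h * (v j * ?g) = m j * (v h * ?g)"
      using cross[OF j] by (simp add: mult.assoc[symmetric])
    also have "\<dots> = m h * (t * m j)"
      unfolding t by (simp add: ac_simps)
    finally have "m h * (v j * ?g) = m h * (t * m j)" .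
    then have "v j * ?g = t * m j" using h(2) by simp
    also have "\<dots> = t * (m j div ?g) * ?g" using g(1) by simp
    finally show ?thesis using \<open>?g \<noteq> 0\<close> by simp
  qed
  then show ?thesis by blast
qed

lemma sgn_div_Gcd:
  fixes m :: "'a \<Rightarrow> int"
  assumes "j \<in> B" "m j \<noteq> 0"
  shows "sgn (m j div Gcd (m ` B)) = sgn (m j)"
proof -
  let ?g = "Gcd (m ` B)"
  have "?g dvd m j" using assms by auto
  moreover from this have "?g > 0"
    using assms(2) Gcd_int_greater_eq_0[of "m ` B"] by (metis dvd_0_left order_le_less)
  ultimately show ?thesis
    using sgn_mult[of ?g "m j div ?g"] by simp
qed

context
  fixes A G :: "int mat" and B :: "nat list" and b :: "int vec"
  assumes gale: "gale_transform A G" and bouquet: "set B \<in> bouquets G" and vec: "bouquet_vector G B b"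
begin

private lemma head: "hd B \<in> set B"
  using bouquetD(1)[OF bouquet] by simp

private lemma range: "j \<in> set B \<Longrightarrow> j < dim_row G"
  using bouquetD(2)[OF bouquet] by auto

private lemma dim: "dim_row G = dim_col A"
  using gale by (simp add: gale_transform_def)

private lemma non_free_form:
  assumes "\<not> free_bouquet G (set B)"
  obtains m where "\<And>j. j \<in> set B \<Longrightarrow> m j \<noteq> 0"
    "\<And>i j q. i \<in> set B \<Longrightarrow> j \<in> set B \<Longrightarrow> proportional_rows G i j q \<Longrightarrow> rat_of_int (m i) = q * rat_of_int (m j)"
    "\<And>j. j < dim_row G \<Longrightarrow> b $ j = (if j \<in> set B then sgn (m (hd B)) * (m j div Gcd (m ` set B)) else 0)"
proof -
  obtain l where l: "l < dim_col G" "\<forall>j \<in> set B. G $$ (j, l) \<noteq> 0"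
    "b = vec (dim_row G) (\<lambda>j. if j \<in> set B
       then sgn (G $$ (hd B, l)) * (G $$ (j, l) div Gcd ((\<lambda>i. G $$ (i, l)) ` set B)) else 0)"
    using vec assms unfolding bouquet_vector_def by auto
  show thesis
    by (rule that[of "\<lambda>j. G $$ (j, l)"]) (use l in \<open>auto simp: proportional_rows_def\<close>)
qed

private lemma sgn_non_free:
  assumes "\<And>j. j \<in> set B \<Longrightarrow> m j \<noteq> 0"
    "\<And>j. j < dim_row G \<Longrightarrow> b $ j = (if j \<in> set B then sgn (m (hd B)) * (m j div Gcd (m ` set B)) else 0)"
    and "j \<in> set B"
  shows "sgn (b $ j) = sgn (m (hd B)) * sgn (m j)"
  using assms range[of j] sgn_div_Gcd[of j "set B" m] by (simp add: sgn_mult)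

lemma bouquet_vector_support:
  assumes "j < dim_row G"
  shows "b $ j \<noteq> 0 \<longleftrightarrow> j \<in> set B"
proof (cases "free_bouquet G (set B)")
  case True
  then show ?thesis using vec assms unfolding bouquet_vector_def by auto
next
  case False
  then obtain m where m: "\<And>j. j \<in> set B \<Longrightarrow> m j \<noteq> 0"
    "\<And>j. j < dim_row G \<Longrightarrow> b $ j = (if j \<in> set B then sgn (m (hd B)) * (m j div Gcd (m ` set B)) else 0)"
    using non_free_form by metis
  show ?thesis
    using sgn_non_free[OF m, of j] m head assms by (cases "j \<in> set B") (auto simp: sgn_0_0)
qed

lemma bouquet_vector_head: "0 < b $ hd B"
proof (cases "free_bouquet G (set B)")
  case True
  then show ?thesis using vec unfolding bouquet_vector_def by auto
next
  case False
  then obtain m where m: "\<And>j. j \<in> set B \<Longrightarrow> m j \<noteq> 0"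
    "\<And>j. j < dim_row G \<Longrightarrow> b $ j = (if j \<in> set B then sgn (m (hd B)) * (m j div Gcd (m ` set B)) else 0)"
    using non_free_form by metis
  have "sgn (b $ hd B) = 1"
    using sgn_non_free[OF m head] m(1)[OF head] by (simp add: sgn_if split: if_splits)
  then show ?thesis by (simp add: sgn_1_pos)
qed

text \<open>
  Relative to the head, every row of a non-mixed bouquet has a positive proportionality factor.
\<close>

lemma bouquet_vector_non_mixed:
  assumes "non_mixed_bouquet G (set B)" "j \<in> set B"
  shows "0 < b $ j"
proof (cases "j = hd B")
  case False
  obtain m where m: "\<And>j. j \<in> set B \<Longrightarrow> m j \<noteq> 0"
    "\<And>i j q. i \<in> set B \<Longrightarrow> j \<in> set B \<Longrightarrow> proportional_rows G i j q \<Longrightarrow> rat_of_int (m i) = q * rat_of_int (m j)"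
    "\<And>j. j < dim_row G \<Longrightarrow> b $ j = (if j \<in> set B then sgn (m (hd B)) * (m j div Gcd (m ` set B)) else 0)"
    using non_free_form assms(1) unfolding non_mixed_bouquet_def by metis
  obtain q where q: "q \<noteq> 0" "proportional_rows G j (hd B) q"
    using bouquetD(3)[OF bouquet assms(2) head] by blast
  then have "(j, hd B) \<in> bouquet_edges G"
    using range assms(2) head False by (auto simp: bouquet_edges_iff)
  then have "0 < q"
    using assms q head rat_row_eq_iff[OF range[OF assms(2)] range[OF head]]
    unfolding non_mixed_bouquet_def mixed_bouquet_def by (metis linorder_neqE_linordered_idom)
  then have "sgn (rat_of_int (m j)) = sgn (rat_of_int (m (hd B)))"
    using m(2)[OF assms(2) head q(2)] by (simp add: sgn_mult)
  then have "sgn (m j) = sgn (m (hd B))" by (simp add: sgn_if split: if_splits)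
  then have "sgn (b $ j) = 1"
    using sgn_non_free[OF m(1,3) assms(2)] m(1)[OF head] by (simp add: sgn_if split: if_splits)
  then show ?thesis by (simp add: sgn_1_pos)
qed (use bouquet_vector_head in simp)

lemma bouquet_vector_mixed:
  assumes "mixed_bouquet G (set B)"
  shows "\<exists>j \<in> set B. b $ j < 0"
proof -
  obtain m where m: "\<And>j. j \<in> set B \<Longrightarrow> m j \<noteq> 0"
    "\<And>i j q. i \<in> set B \<Longrightarrow> j \<in> set B \<Longrightarrow> proportional_rows G i j q \<Longrightarrow> rat_of_int (m i) = q * rat_of_int (m j)"
    "\<And>j. j < dim_row G \<Longrightarrow> b $ j = (if j \<in> set B then sgn (m (hd B)) * (m j div Gcd (m ` set B)) else 0)"
    using non_free_form assms unfolding mixed_bouquet_def by metis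
  obtain i j q where ij: "i \<in> set B" "j \<in> set B" and q: "q < 0" "rat_row G i = q \<cdot>\<^sub>v rat_row G j"
    using assms unfolding mixed_bouquet_def by blast
  then have "rat_of_int (m i) = q * rat_of_int (m j)"
    using m(2) rat_row_eq_iff range by blast
  then have "sgn (rat_of_int (m i)) = - sgn (rat_of_int (m j))"
    using q(1) by (simp add: sgn_mult)
  then have "sgn (m i) = - sgn (m j)" by (simp add: sgn_if split: if_splits)
  then have "sgn (b $ i) = - sgn (b $ j)"
    using sgn_non_free[OF m(1,3)] ij by simp
  moreover have "b $ i \<noteq> 0" "b $ j \<noteq> 0"
    using bouquet_vector_support range ij by blast+
  ultimately have "b $ i < 0 \<or> b $ j < 0" by (auto simp: sgn_if split: if_splits)
  then show ?thesis using ij by blast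
qed

text \<open>
  This gives surjectivity of the bouquet map: on each bouquet a kernel vector is an integer multiple
  of the vector attached to the bouquet.
\<close>

lemma kernel_multiple_of_bouquet_vector:
  assumes v: "v \<in> mat_kernel A"
  shows "\<exists>t. \<forall>j \<in> set B. v $ j = t * b $ j"
proof (cases "free_bouquet G (set B)")
  case True
  then have "v $ j = 0 * b $ j" if "j \<in> set B" for j
    using kernel_entry_of_free[OF gale v] that range[OF that] dim by (simp add: free_bouquet_def)
  then show ?thesis by blast
next
  case False
  then obtain m where m: "\<And>j. j \<in> set B \<Longrightarrow> m j \<noteq> 0"
    "\<And>i j q. i \<in> set B \<Longrightarrow> j \<in> set B \<Longrightarrow> proportional_rows G i j q \<Longrightarrow> rat_of_int (m i) = q * rat_of_int (m j)"
    "\<And>j. j < dim_row G \<Longrightarrow> b $ j = (if j \<in> set B then sgn (m (hd B)) * (m j div Gcd (m ` set B)) else 0)"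
    using non_free_form by metis
  have cross: "m (hd B) * v $ j = m j * v $ hd B" if j: "j \<in> set B" for j
  proof -
    obtain q where q: "proportional_rows G j (hd B) q" using bouquetD(3)[OF bouquet j head] by blast
    have "rat_of_int (m (hd B)) * rat_of_int (v $ j) = rat_of_int (m j) * rat_of_int (v $ hd B)"
      using m(2)[OF j head q] kernel_entries_proportional[OF gale v _ _ q] range[OF j] range[OF head] dim
      by simp
    then show ?thesis by (metis of_int_eq_iff of_int_mult)
  qed
  obtain t where t: "\<forall>j \<in> set B. v $ j = t * (m j div Gcd (m ` set B))"
    using common_factor_of_proportional[where h = "hd B" and B = "set B" and m = m and v = "\<lambda>j. v $ j"]
      head m(1)[OF head] cross by blast
  have "sgn (m (hd B)) * sgn (m (hd B)) = 1" using m(1)[OF head] by (simp add: sgn_if)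
  then have "v $ j = t * sgn (m (hd B)) * b $ j" if "j \<in> set B" for j
    using that t m(3)[OF range[OF that]] by (simp add: algebra_simps)
  then show ?thesis by blast
qed

end

section \<open>The bouquet map as a signed lift\<close>

lemma bouquet_matrix_kernel_iff:
  assumes cs: "set cs \<subseteq> carrier_vec (dim_col A)" and u: "u \<in> carrier_vec (length cs)"
  shows "u \<in> mat_kernel (bouquet_matrix A cs) \<longleftrightarrow> bouquet_map A cs u \<in> mat_kernel A"
proof -
  let ?C = "mat_of_cols (dim_col A) cs"
  have "bouquet_matrix A cs = A * ?C"
    by (rule eq_matI) (use cs in \<open>auto simp: bouquet_matrix_def mat_of_cols_index subset_iff\<close>)
  moreover have "?C *\<^sub>v u \<in> carrier_vec (dim_col A)"
    using u by (intro mult_mat_vec_carrier[of _ _ "length cs"]) simp_all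
  ultimately show ?thesis
    using u by (simp add: mat_kernel_iff bouquet_map_def assoc_mult_mat_vec[of A "dim_row A" "dim_col A" ?C "length cs"])
qed

text \<open>
  The lattice is recovered from the ideal, so equality of ideals may be replaced by equality of
  kernels.
\<close>

lemma mat_kernel_eq_if_toric_ideal_eq:
  assumes "dim_col M = dim_col N" "(toric_ideal M :: 'k::field mpoly set) = toric_ideal N"
  shows "mat_kernel M = mat_kernel N"
proof (rule Set.set_eqI)
  fix u
  show "u \<in> mat_kernel M \<longleftrightarrow> u \<in> mat_kernel N"
  proof (cases "u \<in> carrier_vec (dim_col M)")
    case True
    then show ?thesis
      using binom_in_toric_ideal_iff[of u M, where 'k = 'k] binom_in_toric_ideal_iff[of u N, where 'k = 'k] assms
      by simp
  qed (use assms(1) in \<open>simp add: mat_kernel_iff\<close>)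
qed

text \<open>
  The position \<open>j\<close> belongs to exactly one bouquet, whose number is \<open>\<beta> j\<close>, and \<open>c j\<close> is its entry
  in the vector of that bouquet. The head of each bouquet is a positive copy of the coordinate, which
  gives injectivity; surjectivity holds because kernel vectors are integer multiples of the bouquet
  vectors.
\<close>

lemma robust_via_signed_lift:
  assumes "robust_via TYPE('k::field) T \<omega> A G Bs cs"
  shows "\<exists>\<beta> c. signed_lift T A \<omega> (bouquet_map A cs) \<beta> c"
proof -
  let ?n = "dim_col A" and ?s = "dim_col T" and ?D = "bouquet_map A cs"
  have gale: "gale_transform A G" and dist: "distinct (concat Bs)" and Bs: "set ` set Bs = bouquets G"
    and len: "length Bs = ?s" "length cs = ?s"
    and vecs: "\<And>i. i < ?s \<Longrightarrow> bouquet_vector G (Bs ! i) (cs ! i)"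
    and ideal: "(toric_ideal (bouquet_matrix A cs) :: 'k mpoly set) = toric_ideal T"
    and \<omega>: "\<omega> = {i. i < ?s \<and> non_mixed_bouquet G (set (Bs ! i))}"
    using assms unfolding robust_via_def bouquet_data_def by auto
  have dim: "dim_row G = ?n" using gale by (simp add: gale_transform_def)
  have bouquet: "set (Bs ! i) \<in> bouquets G" if "i < ?s" for i
    using imageI[OF nth_mem[of i Bs], of set] that len unfolding Bs by simp
  have head: "hd (Bs ! i) \<in> set (Bs ! i)" if "i < ?s" for i
    using bouquetD(1)[OF bouquet[OF that]] by simp
  have head_less: "hd (Bs ! i) < ?n" if "i < ?s" for i
    using subsetD[OF bouquetD(2)[OF bouquet[OF that]] head[OF that]] dim by simp
  have disjoint: "i = k" if "i < ?s" "k < ?s" "j \<in> set (Bs ! i)" "j \<in> set (Bs ! k)" for i k j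
  proof -
    have "[] \<notin> set Bs" using bouquetD(1) Bs by fastforce
    then have "distinct Bs" using dist by (simp add: distinct_concat_iff removeAll_id)
    moreover have "Bs ! i \<in> set Bs" "Bs ! k \<in> set Bs" using that len by simp_all
    then have "Bs ! i = Bs ! k" using dist that(3,4) unfolding distinct_concat_iff by blast
    ultimately show ?thesis using that len nth_eq_iff_index_eq by metis
  qed
  have "\<exists>i<?s. j \<in> set (Bs ! i)" if j: "j < ?n" for j
  proof -
    obtain xs where xs: "xs \<in> set Bs" "j \<in> set xs"
      using bouquets_cover[of j G] j dim unfolding Bs[symmetric] by auto
    then obtain i where "i < length Bs" "xs = Bs ! i" by (metis in_set_conv_nth)
    then show ?thesis using len(1) xs(2) by auto
  qed
  then obtain \<beta> where \<beta>: "\<And>j. j < ?n \<Longrightarrow> \<beta> j < ?s \<and> j \<in> set (Bs ! \<beta> j)" by metis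
  have \<beta>_eq: "\<beta> j = i" if "j \<in> set (Bs ! i)" "i < ?s" for i j
    using that \<beta>[of j] disjoint[of i "\<beta> j" j] bouquetD(2)[OF bouquet] dim by fastforce
  define c where "c j = cs ! \<beta> j $ j" for j
  have support: "cs ! i $ j \<noteq> 0 \<longleftrightarrow> \<beta> j = i" if "i < ?s" "j < ?n" for i j
    using bouquet_vector_support[OF gale bouquet[OF that(1)] vecs[OF that(1)]] that dim \<beta> \<beta>_eq by metis
  have cs: "set cs \<subseteq> carrier_vec ?n"
    using vecs len dim unfolding bouquet_vector_def by (auto simp: in_set_conv_nth)
  have lift: "?D u = vec ?n (\<lambda>j. c j * u $ \<beta> j)" if u: "u \<in> carrier_vec ?s" for u
  proof (rule eq_vecI)
    fix j assume "j < dim_vec (vec ?n (\<lambda>j. c j * u $ \<beta> j))"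
    then have j: "j < ?n" by simp
    have "?D u $ j = (\<Sum>i<?s. cs ! i $ j * u $ i)"
      using j u len by (simp add: bouquet_map_def scalar_prod_def lessThan_atLeast0 mat_of_cols_index)
    also have "\<dots> = (\<Sum>i<?s. if i = \<beta> j then c j * u $ \<beta> j else 0)"
      using support[OF _ j] by (intro sum.cong) (auto simp: c_def)
    also have "\<dots> = c j * u $ \<beta> j" using \<beta>[OF j] by simp
    finally show "?D u $ j = vec ?n (\<lambda>j. c j * u $ \<beta> j) $ j" using j by simp
  qed (simp add: bouquet_map_def)
  have ker: "u \<in> mat_kernel T \<longleftrightarrow> ?D u \<in> mat_kernel A" if "u \<in> carrier_vec ?s" for u
    using bouquet_matrix_kernel_iff[OF cs] mat_kernel_eq_if_toric_ideal_eq[OF _ ideal] that len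
    by (simp add: bouquet_matrix_def)
  have c_head: "\<beta> (hd (Bs ! i)) = i" "0 < c (hd (Bs ! i))" if "i < ?s" for i
    using bouquet_vector_head[OF gale bouquet[OF that] vecs[OF that]] \<beta>_eq[OF head[OF that] that] that
    by (auto simp: c_def)
  have head_entry: "?D u $ hd (Bs ! i) = c (hd (Bs ! i)) * u $ i" if "u \<in> carrier_vec ?s" "i < ?s" for u i
    using that lift head_less c_head(1) by simp
  have bij: "bij_betw ?D (mat_kernel T) (mat_kernel A)"
  proof (rule bij_betw_imageI)
    show "inj_on ?D (mat_kernel T)"
    proof (rule inj_onI)
      fix u w assume uw: "u \<in> mat_kernel T" "w \<in> mat_kernel T" "?D u = ?D w"
      note car = kernel_carrier[OF uw(1)] kernel_carrier[OF uw(2)]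
      have "u $ i = w $ i" if "i < ?s" for i
        using head_entry[OF car(1) that] head_entry[OF car(2) that] uw(3) c_head(2)[OF that] by simp
      then show "u = w" using car by auto
    qed
    have "v \<in> ?D ` mat_kernel T" if v: "v \<in> mat_kernel A" for v
    proof -
      have "\<forall>i. \<exists>t. i < ?s \<longrightarrow> (\<forall>j \<in> set (Bs ! i). v $ j = t * cs ! i $ j)"
        using kernel_multiple_of_bouquet_vector[OF gale bouquet vecs v] by blast
      then obtain t where "\<forall>i. i < ?s \<longrightarrow> (\<forall>j \<in> set (Bs ! i). v $ j = t i * cs ! i $ j)"
        unfolding choice_iff by (elim exE)
      then have t: "v $ j = t i * cs ! i $ j" if "i < ?s" "j \<in> set (Bs ! i)" for i j
        using that by simp
      have "v = ?D (vec ?s t)"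
      proof (rule eq_vecI)
        fix j assume "j < dim_vec (?D (vec ?s t))"
        then have j: "j < ?n" by (simp add: bouquet_map_def)
        show "v $ j = ?D (vec ?s t) $ j"
          using j \<beta>[OF j] t[of "\<beta> j" j] by (simp add: lift c_def)
      qed (use kernel_carrier[OF v] in \<open>simp add: bouquet_map_def\<close>)
      then show ?thesis using ker[of "vec ?s t"] v by auto
    qed
    then show "?D ` mat_kernel T = mat_kernel A"
      using ker kernel_carrier by blast
  qed
  have "signed_lift T A \<omega> ?D \<beta> c"
  proof
    show "\<beta> j < ?s" "c j \<noteq> 0" if "j < ?n" for j
      using \<beta>[OF that] support[OF _ that] by (auto simp: c_def)
    show "\<exists>j<?n. \<beta> j = i \<and> 0 < c j" if "i < ?s" for i
      using head_less[OF that] c_head[OF that] by blast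
    show "0 < c j" if "j < ?n" "\<beta> j \<in> \<omega>" for j
      using bouquet_vector_non_mixed[OF gale bouquet vecs] \<beta>[OF that(1)] that(2) unfolding \<omega> c_def by blast
    show "(\<exists>j<?n. \<beta> j = i \<and> c j < 0) \<or> (\<forall>w \<in> mat_kernel T. w $ i = 0)" if i: "i < ?s" "i \<notin> \<omega>" for i
    proof (cases "free_bouquet G (set (Bs ! i))")
      case True
      have "w $ i = 0" if w: "w \<in> mat_kernel T" for w
      proof -
        have "?D w $ hd (Bs ! i) = 0"
          using kernel_entry_of_free[OF gale _ head_less[OF i(1)], of "?D w"] True head[OF i(1)]
            ker[OF kernel_carrier[OF w]] w by (simp add: free_bouquet_def)
        then show ?thesis
          using head_entry[OF kernel_carrier[OF w] i(1)] c_head(2)[OF i(1)] by simp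
      qed
      then show ?thesis by blast
    next
      case False
      then have "mixed_bouquet G (set (Bs ! i))" using i unfolding \<omega> non_mixed_bouquet_def by blast
      then obtain j where j: "j \<in> set (Bs ! i)" "cs ! i $ j < 0"
        using bouquet_vector_mixed[OF gale bouquet[OF i(1)] vecs[OF i(1)]] by blast
      then have "j < ?n" "\<beta> j = i" using \<beta>_eq[OF j(1) i(1)] bouquetD(2)[OF bouquet[OF i(1)]] dim by auto
      then show ?thesis using j(2) unfolding c_def by blast
    qed
  qed (fact lift bij)+
  then show ?thesis by blast
qed

section \<open>The strongly robustness complex\<close>

theorem theorem3p6:
  fixes T A :: "int mat" and \<omega> :: "nat set"
  assumes "positively_graded T" and "simple_toric T"
    and "\<omega> \<subseteq> {..<dim_col T}"
    and "T_robust TYPE('k::field) T \<omega> A"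
  shows "strongly_robust TYPE('k) A \<longleftrightarrow> \<omega> \<in> robustness_complex TYPE('k) T"
proof -
  \<comment> \<open>The right-hand side involves only \<open>T\<close> and \<open>\<omega>\<close>, so any robust ideal may be used to test it.\<close>
  have indispensable: "bouquet_map A' cs u \<in> indispensable TYPE('k) A' \<longleftrightarrow> \<not> splits_with_signs T \<omega> u"
    if via: "robust_via TYPE('k) T \<omega> A' G Bs cs" and u: "u \<in> primitive_kernel T" for A' G Bs cs u
  proof -
    obtain \<beta> c where lift: "signed_lift T A' \<omega> (bouquet_map A' cs) \<beta> c"
      using robust_via_signed_lift[OF via] by (elim exE)
    have "positively_graded A'" using via unfolding robust_via_def by (elim conjE)
    then show ?thesis by (rule signed_lift.lift_indispensable_iff[OF lift _ u])
  qed
  obtain G Bs cs where via: "robust_via TYPE('k) T \<omega> A G Bs cs"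
    using assms(4) unfolding T_robust_def by (elim exE)
  obtain \<beta> c where lift: "signed_lift T A \<omega> (bouquet_map A cs) \<beta> c"
    using robust_via_signed_lift[OF via] by (elim exE)
  have "positively_graded A" using via unfolding robust_via_def by (elim conjE)
  then have "strongly_robust TYPE('k) A \<longleftrightarrow> (\<forall>u \<in> primitive_kernel T. \<not> splits_with_signs T \<omega> u)"
    by (rule signed_lift.strongly_robust_iff_no_signed_split[OF lift])
  also have "\<dots> \<longleftrightarrow> S_omega TYPE('k) T \<omega> = primitive_kernel T"
  proof -
    have "u \<in> S_omega TYPE('k) T \<omega> \<longleftrightarrow> \<not> splits_with_signs T \<omega> u" if u: "u \<in> primitive_kernel T" for u
      using indispensable[OF _ u] u via unfolding S_omega_def graver_eq by fast
    moreover have "S_omega TYPE('k) T \<omega> \<subseteq> primitive_kernel T"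
      unfolding S_omega_def graver_eq by simp
    ultimately show ?thesis by blast
  qed
  also have "\<dots> \<longleftrightarrow> \<omega> \<in> robustness_complex TYPE('k) T"
    using assms(3) by (simp add: robustness_complex_def graver_eq)
  finally show ?thesis .
qed

end
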